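(* Let $b\ge2$ be an integer, $\gamma\in(0,1)$, and let $\phi:\mathbb{R}\to\mathbb{R}$ be a $\mathbb{Z}$-periodic Lipschitz function. Then (1) $\omega$ is exact dimensional; (2) there is a constant $\alpha\in[0,1]$ such that for Lebesgue-a.e. $x\in[0,1]$, $m_x$ is exact dimensional and $\dim(m_x)=\alpha$; (3) $\dim(\omega)=1+\alpha$.
   Context: $\Lambda=\{0,\dots,b-1\}$, $\Sigma=\Lambda^{\mathbb{Z}_+}$, $\nu$ the uniform probability on $\Lambda$. For $\mathbf{j}\in\Sigma$ and $x\in[0,1]$, $S(x,\mathbf{j})=\sum_{n\ge1}\gamma^{n-1}\phi\big(\frac{x+j_1+j_2b+\cdots+j_nb^{n-1}}{b^n}\big)$, and $m_x$ is the image of $\nu^{\mathbb{Z}_+}$ under $\mathbf{j}\mapsto S(x,\mathbf{j})$. $\omega$ is the SRB measure of $T(x,y)=(bx\bmod1,\gamma y+\phi(x))$ on $[0,1)\times\mathbb{R}$, i.e. the ergodic probability measure such that Lebesgue-a.e. point $z$ has $\frac1n\sum_{k<n}\delta_{T^kz}\to\omega$ weakly; equivalently $\omega=\int_{[0,1)}\delta_x\times m_x\,dx$. A probability measure $\mu$ is exact dimensional if for some $\beta$, $\lim_{r\to0}\log\mu(B(z,r))/\log r=\beta$ for $\mu$-a.e. $z$; then $\dim(\mu)=\beta$. *)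

theory Defs
  imports "HOL-Probability.Probability"
begin

text \<open>Digit sequences j = (j_1, j_2, ...) are represented as functions nat => nat,
  with j_k stored at index k-1. The Bernoulli measure nu^{Z+} is the infinite
  product of uniform measures on {0..<b}.\<close>

definition digit_measure :: "nat \<Rightarrow> (nat \<Rightarrow> nat) measure" where
  "digit_measure b = PiM UNIV (\<lambda>_::nat. uniform_count_measure {0..<b})"

text \<open>S(x,j) = sum_{n>=1} gamma^(n-1) phi((x + j_1 + j_2 b + ... + j_n b^(n-1)) / b^n),
  written with n shifted by one.\<close>
definition S_fun :: "nat \<Rightarrow> real \<Rightarrow> (real \<Rightarrow> real) \<Rightarrow> real \<Rightarrow> (nat \<Rightarrow> nat) \<Rightarrow> real" where
  "S_fun b \<gamma> \<phi> x j =
     (\<Sum>n. \<gamma> ^ n * \<phi> ((x + (\<Sum>k\<le>n. real (j k) * real b ^ k)) / real b ^ (n + 1)))"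

definition m_meas :: "nat \<Rightarrow> real \<Rightarrow> (real \<Rightarrow> real) \<Rightarrow> real \<Rightarrow> real measure" where
  "m_meas b \<gamma> \<phi> x = distr (digit_measure b) borel (S_fun b \<gamma> \<phi> x)"

definition omega_meas :: "nat \<Rightarrow> real \<Rightarrow> (real \<Rightarrow> real) \<Rightarrow> (real \<times> real) measure" where
  "omega_meas b \<gamma> \<phi> = measure_of UNIV (sets borel)
     (\<lambda>A. \<integral>\<^sup>+ x. indicator {0..<1} x * emeasure (m_meas b \<gamma> \<phi> x) (Pair x -` A) \<partial>lborel)"

definition exact_dimensional :: "'a::metric_space measure \<Rightarrow> real \<Rightarrow> bool" where
  "exact_dimensional \<mu> \<beta> \<longleftrightarrow>
     (AE z in \<mu>. ((\<lambda>r. ln (measure \<mu> (ball z r)) / ln r) \<longlongrightarrow> \<beta>) (at_right 0))"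

end

theory Submission
  imports Defs "HOL-Real_Asymp.Real_Asymp"
begin

text \<open>
  Let \<open>F (x, j) = ((x + j\<^sub>1) / b, shift j)\<close>, which preserves Lebesgue measure times the Bernoulli measure
  and is ergodic, being a two-sided Bernoulli shift in disguise. From
  \<open>S (x, j) = \<phi> ((x + j\<^sub>1) / b) + \<gamma> * S (F (x, j))\<close> it follows that, up to the factor \<open>1 / b\<close>, the mass that
  the cylinder of \<open>j\<^sub>1\<close> contributes to the ball of radius \<open>R \<gamma>\<^sup>n\<close> around \<open>S (x, j)\<close> is the \<open>m\<close>-mass of the ball
  of radius \<open>R \<gamma>\<^sup>n\<^sup>-\<^sup>1\<close> at \<open>F (x, j)\<close>. Hence the logarithm of the mass of a ball is a sum, along the
  \<open>F\<close>-orbit, of logarithms of the conditional mass of the cylinder of \<open>j\<^sub>1\<close> in smaller and smaller balls.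
  These conditional masses converge almost everywhere by differentiation of measures on the line, with an
  integrable bound from the one-dimensional maximal inequality, so Maker's ergodic theorem gives the
  local dimension of \<open>m\<^sub>x\<close>. Finally, \<open>S\<close> is uniformly Lipschitz in \<open>x\<close>, so the \<open>\<omega>\<close>-mass of a ball of radius \<open>r\<close>
  around \<open>(x, y)\<close> is comparable to \<open>r\<close> times the \<open>m\<^sub>x\<close>-mass of a ball of comparable radius around \<open>y\<close>.
\<close>

section \<open>The ergodic theorems of Birkhoff and Maker\<close>

text \<open>Sequences with different first digits may land in the same ball, so the mass of a ball
  is not just a power of \<open>1 / b\<close>; the conditional masses measure this overlap. While
  the orbit advances, the scale is used up: after \<open>k\<close> of \<open>n\<close> steps the
  summand is \<open>f (n - k)\<close>. No fixed function is averaged, which is why Birkhoff's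
  theorem alone does not suffice. The fibre measures may be singular and far from doubling, so
  differentiation rests on the order of the line: a finite cover by intervals can be thinned to
  multiplicity two. The resulting inequality has the same constant for all finite measures. Applied
  to the whole fibre measure against the part carried by one digit, it bounds all scales at once,
  with exponential tails uniform in \<open>x\<close>. The dimension comes out as
  \<open>(ln b - I) / (- ln \<gamma>)\<close>, where \<open>I\<close> is the integral of the limit
  of \<open>f n\<close>: an entropy divided by a contraction rate. It does not depend on the fibre
  because \<open>x\<close> is itself a coordinate of the ergodic system.\<close>

locale measure_preserving = prob_space M for M :: "'a measure" +
  fixes F :: "'a \<Rightarrow> 'a"
  assumes F_measurable [measurable]: "F \<in> measurable M M"
    and distr_F: "distr M M F = M"
begin

lemma funpow_measurable [measurable]: "F ^^ n \<in> measurable M M"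
  by (induction n) (auto intro!: measurable_comp[of _ M M F M])

lemma distr_funpow: "distr M M (F ^^ n) = M"
proof (induction n)
  case (Suc n)
  have "distr M M (F ^^ Suc n) = distr (distr M M (F ^^ n)) M F"
    using distr_distr[OF F_measurable funpow_measurable, of n] by (simp add: comp_def)
  then show ?case by (simp only: Suc distr_F)
qed (simp add: id_def)

lemma AE_funpow: 
  assumes "AE x in M. P x"
  shows "AE x in M. \<forall>n. P ((F ^^ n) x)"
  unfolding AE_all_countable
proof
  fix n
  have "AE x in distr M M (F ^^ n). P x" using assms by (subst distr_funpow)
  from AE_distrD[OF funpow_measurable this] show "AE x in M. P ((F ^^ n) x)" .
qed

lemma integrable_F: "integrable M f \<Longrightarrow> integrable M (\<lambda>x. f (F x))" for f :: "'a \<Rightarrow> real"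
  using integrable_distr[OF F_measurable, of f] by (simp add: distr_F)

lemma integral_F: "f \<in> borel_measurable M \<Longrightarrow> (\<integral>x. f (F x) \<partial>M) = (\<integral>x. f x \<partial>M)" for f :: "'a \<Rightarrow> real"
  using integral_distr[OF F_measurable, of f] by (simp add: distr_F)

end

section \<open>Maximal partial sums and Birkhoff's theorem\<close>

locale ergodic_system = measure_preserving +
  assumes ergodic: "\<And>A. A \<in> sets M \<Longrightarrow> F -` A \<inter> space M = A \<Longrightarrow> prob A = 0 \<or> prob A = 1"
begin

definition birkhoff_sum :: "('a \<Rightarrow> real) \<Rightarrow> nat \<Rightarrow> 'a \<Rightarrow> real" where
  "birkhoff_sum f n x = (\<Sum>k<n. f ((F ^^ k) x))"

lemma birkhoff_sum_Suc: "birkhoff_sum f (Suc n) x = f x + birkhoff_sum f n (F x)"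
  unfolding birkhoff_sum_def by (subst sum.lessThan_Suc_shift) (simp add: funpow_swap1)

text \<open>Unfolds to the largest \<open>birkhoff_sum f k x\<close> with k \<le> n, the empty sum
  included. The recursive form makes the relation between \<open>birkhoff_max f (Suc n)\<close> and
  \<open>birkhoff_max f n\<close> at \<open>F x\<close> hold by definition.\<close>

primrec birkhoff_max :: "('a \<Rightarrow> real) \<Rightarrow> nat \<Rightarrow> 'a \<Rightarrow> real" where
  "birkhoff_max f 0 x = 0"
| "birkhoff_max f (Suc n) x = max 0 (f x + birkhoff_max f n (F x))"

lemma birkhoff_max_nonneg: "0 \<le> birkhoff_max f n x"
  by (cases n) auto

lemma birkhoff_sum_le_max: "birkhoff_sum f n x \<le> birkhoff_max f n x"
proof (induction n arbitrary: x)
  case (Suc n)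
  then show ?case using Suc[of "F x"] by (auto simp: birkhoff_sum_Suc le_max_iff_disj)
qed (simp add: birkhoff_sum_def)

lemma birkhoff_max_Suc_mono: "birkhoff_max f n x \<le> birkhoff_max f (Suc n) x"
proof (induction n arbitrary: x)
  case (Suc n)
  have "max 0 (f x + a) \<le> max 0 (f x + b)" if "a \<le> b" for a b using that by auto
  from this[OF Suc[of "F x"]] show ?case by (simp only: birkhoff_max.simps(2))
qed simp

lemma birkhoff_max_mono: "m \<le> n \<Longrightarrow> birkhoff_max f m x \<le> birkhoff_max f n x"
  by (rule lift_Suc_mono_le[of "\<lambda>n. birkhoff_max f n x"]) (auto simp del: birkhoff_max.simps intro: birkhoff_max_Suc_mono)

lemma birkhoff_max_measurable [measurable]:
  "f \<in> borel_measurable M \<Longrightarrow> birkhoff_max f n \<in> borel_measurable M"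
proof (induction n)
  case (Suc n)
  then have [measurable]: "birkhoff_max f n \<in> borel_measurable M" "f \<in> borel_measurable M" by auto
  show ?case by simp
next
  case 0
  have "birkhoff_max f 0 = (\<lambda>x. 0)" by auto
  then show ?case by simp
qed

lemma birkhoff_max_integrable:
  "integrable M f \<Longrightarrow> integrable M (birkhoff_max f n)"
proof (induction n)
  case (Suc n)
  then show ?case
    by (auto intro!: Bochner_Integration.integrable_max Bochner_Integration.integrable_add integrable_F)
next
  case 0
  have "birkhoff_max f 0 = (\<lambda>x. 0)" by auto
  then show ?case by simp
qed

text \<open>On the invariant set where the partial sums are unbounded above, the differences
  \<open>birkhoff_max f (Suc n) - birkhoff_max f n \<circ> F = max (- birkhoff_max f n \<circ> F) f\<close> decrease to \<open>f\<close>,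
  while their integrals are nonnegative.\<close>

lemma birkhoff_sum_bounded_above:
  assumes f: "integrable M f" and neg: "(\<integral>x. f x \<partial>M) < 0"
  shows "AE x in M. \<exists>c. \<forall>n. birkhoff_sum f n x \<le> c"
proof -
  note [measurable] = borel_measurable_integrable[OF f]
  define E where "E = {x \<in> space M. \<forall>c::nat. \<exists>n. real c < birkhoff_max f n x}"
  have E: "E \<in> sets M" unfolding E_def by measurable
  \<comment> \<open>Passing from \<open>x\<close> to \<open>F x\<close> changes the maximum by at
    most \<open>\<bar>f x\<bar>\<close> and the index by one, so unboundedness is strictly
    invariant, as the ergodicity assumption demands.\<close>
  have "F x \<in> E \<longleftrightarrow> x \<in> E" if x: "x \<in> space M" for x
  proof
    have Fx: "F x \<in> space M" using measurable_space[OF F_measurable x] .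
    assume "F x \<in> E"
    { fix c :: nat
      obtain n where "real (nat \<lceil>real c + \<bar>f x\<bar>\<rceil>) < birkhoff_max f n (F x)"
        using \<open>F x \<in> E\<close> unfolding E_def by blast
      then have "real c < birkhoff_max f (Suc n) x" by (simp; linarith)
      then have "\<exists>n. real c < birkhoff_max f n x" .. }
    then show "x \<in> E" using x by (auto simp: E_def)
  next
    assume "x \<in> E"
    { fix c :: nat
      obtain n where "real (nat \<lceil>real c + \<bar>f x\<bar>\<rceil>) < birkhoff_max f n x"
        using \<open>x \<in> E\<close> unfolding E_def by blast
      also have "\<dots> \<le> birkhoff_max f (Suc n) x" by (rule birkhoff_max_Suc_mono)
      finally have "real c < birkhoff_max f n (F x)" by (simp; linarith)
      then have "\<exists>n. real c < birkhoff_max f n (F x)" .. }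
    then show "F x \<in> E" using measurable_space[OF F_measurable x] by (auto simp: E_def)
  qed
  then have "F -` E \<inter> space M = E" by (auto simp: E_def)
  with ergodic E have "prob E = 0 \<or> prob E = 1" by blast
  moreover have "prob E \<noteq> 1"
  proof
    assume "prob E = 1"
    then have AE: "AE x in M. x \<in> E" by (simp add: AE_in_set_eq_1 E)
    let ?d = "\<lambda>n x. max (- birkhoff_max f n (F x)) (f x)"
    have "(\<lambda>n. \<integral>x. ?d n x \<partial>M) \<longlonglongrightarrow> (\<integral>x. f x \<partial>M)"
    proof (rule integral_dominated_convergence[where w="\<lambda>x. \<bar>f x\<bar>"])
      show "AE x in M. (\<lambda>n. ?d n x) \<longlonglongrightarrow> f x"
        using AE_funpow[OF AE] AE_space
      proof eventually_elim
        fix x assume "\<forall>n. (F ^^ n) x \<in> E" "x \<in> space M"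
        then have "F x \<in> E" by (auto dest!: spec[of _ 1])
        then obtain n where n: "real (nat \<lceil>\<bar>f x\<bar>\<rceil>) < birkhoff_max f n (F x)" unfolding E_def by blast
        \<comment> \<open>Once the maximum at \<open>F x\<close> exceeds
          \<open>\<bar>f x\<bar>\<close>, its negative lies below \<open>f x\<close>; the sequence
          is eventually constant.\<close>
        have "?d m x = f x" if "n \<le> m" for m
          using n birkhoff_max_mono[OF that, of f "F x"] by linarith
        then show "(\<lambda>n. ?d n x) \<longlonglongrightarrow> f x"
          by (intro tendsto_eventually) (auto simp: eventually_sequentially)
      qed
      show "AE x in M. norm (?d n x) \<le> \<bar>f x\<bar>" for n
      proof (rule AE_I2)
        fix x
        show "norm (?d n x) \<le> \<bar>f x\<bar>" using birkhoff_max_nonneg[of f n "F x"] by auto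
      qed
    qed (use f in auto)
    moreover have "0 \<le> (\<integral>x. ?d n x \<partial>M)" for n
    proof -
      have "(\<integral>x. ?d n x \<partial>M) = (\<integral>x. birkhoff_max f (Suc n) x - birkhoff_max f n (F x) \<partial>M)"
        by (intro Bochner_Integration.integral_cong) auto
      also have "\<dots> = (\<integral>x. birkhoff_max f (Suc n) x \<partial>M) - (\<integral>x. birkhoff_max f n (F x) \<partial>M)"
        by (intro Bochner_Integration.integral_diff integrable_F birkhoff_max_integrable f)
      also have "(\<integral>x. birkhoff_max f n (F x) \<partial>M) = (\<integral>x. birkhoff_max f n x \<partial>M)"
        by (intro integral_F) simp
      finally show ?thesis
        using integral_mono[OF birkhoff_max_integrable[OF f] birkhoff_max_integrable[OF f] birkhoff_max_Suc_mono, of n]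
        by simp
    qed
    ultimately have "0 \<le> (\<integral>x. f x \<partial>M)" by (intro LIMSEQ_le_const) auto
    with neg show False by simp
  qed
  ultimately have "AE x in M. x \<notin> E" using E by (simp add: prob_eq_0)
  with AE_space show ?thesis
  proof eventually_elim
    case (elim x)
    then obtain c :: nat where "\<forall>n. birkhoff_max f n x \<le> real c" by (auto simp: E_def not_less)
    then show ?case using birkhoff_sum_le_max order_trans by blast
  qed
qed

theorem birkhoff_ergodic:
  assumes f: "integrable M f"
  shows "AE x in M. (\<lambda>n. birkhoff_sum f n x / n) \<longlonglongrightarrow> (\<integral>x. f x \<partial>M)"
proof -
  let ?I = "\<integral>x. f x \<partial>M"
  have upper: "AE x in M. \<forall>m::nat. eventually (\<lambda>n. birkhoff_sum g n x / n < (\<integral>x. g x \<partial>M) + 2 / Suc m) sequentially"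
    if g: "integrable M g" for g
    unfolding AE_all_countable
  proof
    fix m :: nat
    let ?J = "\<integral>x. g x \<partial>M" and ?e = "1 / Suc m"
    \<comment> \<open>Lowering \<open>g\<close> by slightly more than its mean makes the integral
      negative. One \<open>?e\<close> is spent here, a second one later absorbs
      \<open>c / n\<close>.\<close>
    have "(\<integral>x. g x - (?J + ?e) \<partial>M) < 0"
      using g by (simp add: prob_space)
    then have "AE x in M. \<exists>c. \<forall>n. birkhoff_sum (\<lambda>x. g x - (?J + ?e)) n x \<le> c"
      using g by (intro birkhoff_sum_bounded_above) auto
    then show "AE x in M. eventually (\<lambda>n. birkhoff_sum g n x / n < ?J + 2 / Suc m) sequentially"
    proof eventually_elim
      case (elim x)
      then obtain c where c: "\<And>n. birkhoff_sum (\<lambda>x. g x - (?J + ?e)) n x \<le> c" by blast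
      have *: "birkhoff_sum g n x \<le> c + n * (?J + ?e)" for n
        using c[of n] by (simp add: birkhoff_sum_def sum_subtractf)
      have "eventually (\<lambda>n. c / real n < ?e) sequentially"
        by (intro order_tendstoD[of _ 0] lim_const_over_n) auto
      with eventually_gt_at_top[of 0] show ?case
      proof eventually_elim
        case (elim n)
        have "birkhoff_sum g n x / n \<le> (c + n * (?J + ?e)) / n"
          by (intro divide_right_mono *) auto
        also have "\<dots> = c / n + (?J + ?e)" using elim by (simp add: field_simps)
        also have "\<dots> < ?e + (?J + ?e)" using elim by simp
        also have "\<dots> = ?J + 2 / Suc m" by (simp add: field_simps)
        finally show ?case .
      qed
    qed
  qed
  \<comment> \<open>An upper bound for the averages of \<open>- f\<close> is the missing lower bound
    for those of \<open>f\<close>.\<close>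
  have "integrable M (\<lambda>x. - f x)" using f by simp
  from upper[OF f] upper[OF this] show ?thesis
  proof eventually_elim
    case (elim x)
    show ?case
    proof (rule LIMSEQ_I)
      fix r :: real assume "r > 0"
      then obtain m :: nat where "inverse (Suc m) < r / 2" using reals_Archimedean[of "r/2"] by auto
      then have m: "2 / Suc m < r" by (simp add: field_simps)
      have neg: "birkhoff_sum (\<lambda>x. - f x) n x = - birkhoff_sum f n x" for n
        by (simp add: birkhoff_sum_def sum_negf)
      have "eventually (\<lambda>n. norm (birkhoff_sum f n x / n - ?I) < r) sequentially"
        using elim(1)[rule_format, of m] elim(2)[rule_format, of m]
      proof eventually_elim
        case (elim n)
        with m show ?case by (simp add: abs_less_iff neg)
      qed
      then show "\<exists>no. \<forall>n\<ge>no. norm (birkhoff_sum f n x / n - ?I) < r"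
        by (simp add: eventually_sequentially)
    qed
  qed
qed

text \<open>For \<open>k < n - N\<close> the index \<open>n - k\<close> is above \<open>N\<close>,
  so replacing \<open>g (n - k)\<close> by \<open>f\<close> costs at most \<open>d N\<close>, whose
  mean tends to 0 as \<open>N\<close> grows. The last \<open>N\<close> terms cost at most
  \<open>2 * G\<close> each, and a block of fixed length at the end of a Birkhoff sum is negligible
  against \<open>n\<close>.\<close>

theorem maker_ergodic:
  fixes f :: "'a \<Rightarrow> real" and g :: "nat \<Rightarrow> 'a \<Rightarrow> real"
  assumes [measurable]: "f \<in> borel_measurable M" "\<And>n. g n \<in> borel_measurable M"
    and G: "integrable M G" and bound: "AE x in M. \<forall>n. \<bar>g n x\<bar> \<le> G x"
    and lim: "AE x in M. (\<lambda>n. g n x) \<longlonglongrightarrow> f x"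
  shows "AE x in M. (\<lambda>n. (\<Sum>k<n. g (n - k) ((F ^^ k) x)) / n) \<longlonglongrightarrow> (\<integral>x. f x \<partial>M)"
proof -
  note [measurable] = borel_measurable_integrable[OF G]
  have fG: "AE x in M. \<bar>f x\<bar> \<le> G x"
    using bound lim
  proof eventually_elim
    case (elim x)
    then show ?case by (intro LIMSEQ_le_const2[OF tendsto_rabs[OF elim(2)]]) auto
  qed
  have f: "integrable M f"
    by (rule Bochner_Integration.integrable_bound[OF G]) (use fG in \<open>auto elim!: eventually_mono\<close>)
  \<comment> \<open>On the good set the cap \<open>2 * \<bar>G x\<bar>\<close> changes nothing.
    Everywhere else it keeps the supremum bounded, which serves both measurability and
    integrability.\<close>
  define d where "d N x = (SUP m\<in>{N..}. min \<bar>g m x - f x\<bar> (2 * \<bar>G x\<bar>))" for N x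
  have bdd: "bdd_above ((\<lambda>m. min \<bar>g m x - f x\<bar> (2 * \<bar>G x\<bar>)) ` A)" for A x
    by (intro bdd_aboveI[where M="2 * \<bar>G x\<bar>"]) auto
  have [measurable]: "d N \<in> borel_measurable M" for N
    unfolding d_def by (intro borel_measurable_cSUP) (auto intro!: bdd)
  have d_upper: "min \<bar>g m x - f x\<bar> (2 * \<bar>G x\<bar>) \<le> d N x" if "N \<le> m" for N m x
    unfolding d_def using that by (intro cSUP_upper bdd) auto
  have d_nonneg: "0 \<le> d N x" for N x
    by (rule order_trans[OF _ d_upper[of N N]]) auto
  have d_le: "d N x \<le> 2 * \<bar>G x\<bar>" for N x
    unfolding d_def by (intro cSUP_least) auto
  have d_int: "integrable M (d N)" for N
    by (rule Bochner_Integration.integrable_bound[of _ "\<lambda>x. 2 * \<bar>G x\<bar>"])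
       (use G d_nonneg d_le in \<open>auto simp: abs_of_nonneg\<close>)
  have "(\<lambda>N. \<integral>x. d N x \<partial>M) \<longlonglongrightarrow> (\<integral>x. 0 \<partial>M)"
  proof (rule integral_dominated_convergence[where w="\<lambda>x. 2 * \<bar>G x\<bar>"])
    show "AE x in M. (\<lambda>N. d N x) \<longlonglongrightarrow> 0"
      using lim
    proof eventually_elim
      case (elim x)
      show ?case
      proof (rule LIMSEQ_I)
        fix r :: real assume "r > 0"
        then obtain N where N: "\<And>m. m \<ge> N \<Longrightarrow> \<bar>g m x - f x\<bar> < r / 2"
          using LIMSEQ_D[OF elim, of "r/2"] by auto
        have "d n x < r" if "n \<ge> N" for n
        proof -
          have "min \<bar>g m x - f x\<bar> (2 * \<bar>G x\<bar>) \<le> r / 2" if "n \<le> m" for m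
            using N[of m] that \<open>n \<ge> N\<close> by linarith
          then have "d n x \<le> r / 2" unfolding d_def by (intro cSUP_least) auto
          with \<open>r > 0\<close> show ?thesis by linarith
        qed
        then show "\<exists>no. \<forall>n\<ge>no. norm (d n x - 0) < r"
          using d_nonneg by auto
      qed
    qed
  qed (use G d_nonneg d_le in \<open>auto simp: abs_of_nonneg\<close>)
  then have d_lim: "(\<lambda>N. \<integral>x. d N x \<partial>M) \<longlonglongrightarrow> 0" by simp
  have "AE x in M. \<forall>N. (\<lambda>n. birkhoff_sum (d N) n x / n) \<longlonglongrightarrow> (\<integral>x. d N x \<partial>M)"
    unfolding AE_all_countable using birkhoff_ergodic[OF d_int] by blast
  moreover have "AE x in M. (\<forall>n. \<bar>g n x\<bar> \<le> G x) \<and> \<bar>f x\<bar> \<le> G x"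
    using bound fG by eventually_elim auto
  note AE_funpow[OF this]
  ultimately show ?thesis using birkhoff_ergodic[OF f] birkhoff_ergodic[OF G]
  proof eventually_elim
    case (elim x)
    let ?A = "\<lambda>n. (\<Sum>k<n. g (n - k) ((F ^^ k) x))"
    have b: "\<bar>g n ((F ^^ k) x) - f ((F ^^ k) x)\<bar> \<le> 2 * G ((F ^^ k) x)"
            "\<bar>G ((F ^^ k) x)\<bar> = G ((F ^^ k) x)" for n k
      using elim(2)[rule_format, of k] by (auto dest!: spec[of _ n])
    have key: "\<bar>?A n - birkhoff_sum f n x\<bar> \<le> birkhoff_sum (d N) n x + 2 * (birkhoff_sum G n x - birkhoff_sum G (n - N) x)"
      if "n \<ge> N" for n N
    proof -
      have "\<bar>?A n - birkhoff_sum f n x\<bar> \<le> (\<Sum>k<n. \<bar>g (n - k) ((F ^^ k) x) - f ((F ^^ k) x)\<bar>)"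
        unfolding birkhoff_sum_def sum_subtractf[symmetric] by (rule sum_abs)
      also have "\<dots> \<le> (\<Sum>k<n. d N ((F ^^ k) x) + (if k < n - N then 0 else 2 * G ((F ^^ k) x)))"
      proof (intro sum_mono)
        fix k assume "k \<in> {..<n}"
        show "\<bar>g (n - k) ((F ^^ k) x) - f ((F ^^ k) x)\<bar> \<le> d N ((F ^^ k) x) + (if k < n - N then 0 else 2 * G ((F ^^ k) x))"
        proof (cases "k < n - N")
          case True
          then show ?thesis using d_upper[of N "n - k" "(F ^^ k) x"] b(1)[of "n-k" k] b(2)[of k] by simp
        next
          case False
          then show ?thesis using b(1)[of "n-k" k] d_nonneg[of N "(F ^^ k) x"] by simp
        qed
      qed
      also have "\<dots> = birkhoff_sum (d N) n x + (\<Sum>k\<in>{n-N..<n}. 2 * G ((F ^^ k) x))"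
        unfolding birkhoff_sum_def sum.distrib
        by (intro arg_cong2[where f="(+)"] refl sum.mono_neutral_cong_right) auto
      also have "(\<Sum>k\<in>{n-N..<n}. 2 * G ((F ^^ k) x)) = 2 * (birkhoff_sum G n x - birkhoff_sum G (n - N) x)"
      proof -
        have "{..<n} = {..<n-N} \<union> {n-N..<n}" using that by auto
        then have "birkhoff_sum G n x = birkhoff_sum G (n - N) x + (\<Sum>k\<in>{n-N..<n}. G ((F ^^ k) x))"
          unfolding birkhoff_sum_def by (simp add: sum.union_disjoint ivl_disj_int)
        then show ?thesis by (simp add: sum_distrib_left)
      qed
      finally show ?thesis .
    qed
    have "(\<lambda>n. (?A n - birkhoff_sum f n x) / n) \<longlonglongrightarrow> 0"
    proof (rule LIMSEQ_I)
      fix r :: real assume "r > 0"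
      then obtain N where N: "(\<integral>x. d N x \<partial>M) < r"
        using order_tendstoD(2)[OF d_lim, of r] by (auto simp: eventually_sequentially)
      \<comment> \<open>Both averages of \<open>G\<close> have the same limit, so their difference,
        which is the contribution of the last \<open>N\<close> terms, vanishes.\<close>
      have "(\<lambda>n. birkhoff_sum G (n - N) x / n) \<longlonglongrightarrow> (\<integral>x. G x \<partial>M)"
      proof (rule LIMSEQ_offset[of _ N])
        have "(\<lambda>n. birkhoff_sum G n x / n * (real n / real (n + N))) \<longlonglongrightarrow> (\<integral>x. G x \<partial>M) * 1"
          using elim(4) by (intro tendsto_mult) (auto, real_asymp)
        moreover have "eventually (\<lambda>n. birkhoff_sum G n x / n * (real n / real (n + N)) = birkhoff_sum G (n + N - N) x / real (n + N)) sequentially"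
          using eventually_gt_at_top[of 0] by eventually_elim simp
        ultimately show "(\<lambda>n. birkhoff_sum G (n + N - N) x / real (n + N)) \<longlonglongrightarrow> (\<integral>x. G x \<partial>M)"
          by (simp only: mult_1_right Lim_transform_eventually)
      qed
      then have "(\<lambda>n. birkhoff_sum (d N) n x / n + 2 * (birkhoff_sum G n x / n - birkhoff_sum G (n - N) x / n))
            \<longlonglongrightarrow> (\<integral>x. d N x \<partial>M) + 2 * ((\<integral>x. G x \<partial>M) - (\<integral>x. G x \<partial>M))"
        using elim by (intro tendsto_intros) auto
      then have "eventually (\<lambda>n. birkhoff_sum (d N) n x / n + 2 * (birkhoff_sum G n x / n - birkhoff_sum G (n - N) x / n) < r) sequentially"
        using N by (intro order_tendstoD(2)) auto
      with eventually_ge_at_top[of N] have "eventually (\<lambda>n. norm ((?A n - birkhoff_sum f n x) / n - 0) < r) sequentially"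
      proof eventually_elim
        case (elim n)
        have "norm ((?A n - birkhoff_sum f n x) / n - 0) = \<bar>?A n - birkhoff_sum f n x\<bar> / n" by simp
        also have "\<dots> \<le> (birkhoff_sum (d N) n x + 2 * (birkhoff_sum G n x - birkhoff_sum G (n - N) x)) / n"
          by (intro divide_right_mono key elim) auto
        also have "\<dots> < r" using elim(2) by (simp add: add_divide_distrib diff_divide_distrib)
        finally show ?case .
      qed
      then show "\<exists>no. \<forall>n\<ge>no. norm ((?A n - birkhoff_sum f n x) / n - 0) < r"
        by (simp add: eventually_sequentially)
    qed
    from tendsto_add[OF this elim(3)] show ?case by (simp add: add_divide_distrib[symmetric])
  qed
qed

end

section \<open>Differentiation of measures on the real line\<close>

text \<open>A subfamily with the same union and fewest members works. Among the intervals through a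
  common point, the one reaching furthest left and the one reaching furthest right already cover all
  others, so a third would be redundant.\<close>

lemma finite_interval_subcover:
  fixes \<F> :: "(real \<times> real) set"
  assumes "finite \<F>"
  obtains \<G> where "\<G> \<subseteq> \<F>" "(\<Union>p\<in>\<G>. {fst p<..<snd p}) = (\<Union>p\<in>\<F>. {fst p<..<snd p})"
    "\<And>x. card {p\<in>\<G>. x \<in> {fst p<..<snd p}} \<le> 2"
proof -
  let ?I = "\<lambda>p::real\<times>real. {fst p<..<snd p}"
  let ?P = "\<lambda>\<G>. \<G> \<subseteq> \<F> \<and> (\<Union>p\<in>\<G>. ?I p) = (\<Union>p\<in>\<F>. ?I p)"
  define \<G> where "\<G> = arg_min card ?P"
  have G: "?P \<G>" and min: "\<And>\<H>. ?P \<H> \<Longrightarrow> card \<G> \<le> card \<H>"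
    using arg_min_nat_lemma[of ?P \<F> card] unfolding \<G>_def by auto
  have fin: "finite \<G>" using G assms finite_subset by blast
  have "card {p\<in>\<G>. x \<in> ?I p} \<le> 2" for x
  proof (rule ccontr)
    let ?H = "{p\<in>\<G>. x \<in> ?I p}"
    assume "\<not> card ?H \<le> 2"
    then have ne: "?H \<noteq> {}" and card: "card ?H > 2" by (auto simp del: Collect_empty_eq)
    have finH: "finite ?H" using fin by auto
    obtain A where A: "A \<in> ?H" "\<And>q. q \<in> ?H \<Longrightarrow> fst A \<le> fst q"
    proof -
      have "Min (fst ` ?H) \<in> fst ` ?H" using finH ne by (intro Min_in) blast+
      then obtain A where A: "A \<in> ?H" "Min (fst ` ?H) = fst A" by blast
      have "fst A \<le> fst q" if "q \<in> ?H" for q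
        unfolding A(2)[symmetric] using finH that by (intro Min_le) blast+
      with A(1) show ?thesis by (rule that)
    qed
    obtain B where B: "B \<in> ?H" "\<And>q. q \<in> ?H \<Longrightarrow> snd q \<le> snd B"
    proof -
      have "Max (snd ` ?H) \<in> snd ` ?H" using finH ne by (intro Max_in) blast+
      then obtain B where B: "B \<in> ?H" "Max (snd ` ?H) = snd B" by blast
      have "snd q \<le> snd B" if "q \<in> ?H" for q
        unfolding B(2)[symmetric] using finH that by (intro Max_ge) blast+
      with B(1) show ?thesis by (rule that)
    qed
    have "card {A, B} \<le> 2" by (simp add: card_insert_if)
    then have "\<not> ?H \<subseteq> {A, B}" using card card_mono[of "{A,B}" ?H] by auto
    then obtain C where C: "C \<in> ?H" "C \<noteq> A" "C \<noteq> B" by auto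
    \<comment> \<open>All three intervals contain \<open>x\<close>: the part of \<open>C\<close>
      left of \<open>x\<close> lies in \<open>A\<close>, the rest in \<open>B\<close>.\<close>
    have "y \<in> ?I A \<union> ?I B" if "y \<in> ?I C" for y
      using A(1) A(2)[OF C(1)] B(1) B(2)[OF C(1)] C(1) that by (cases "y < x") auto
    then have "(\<Union>p\<in>\<G> - {C}. ?I p) = (\<Union>p\<in>\<G>. ?I p)" using A(1) B(1) C by blast
    then have "?P (\<G> - {C})" using G by auto
    from min[OF this] have "card \<G> \<le> card (\<G> - {C})" .
    moreover have "C \<in> \<G>" using C by blast
    then have "card (\<G> - {C}) < card \<G>" using fin by (rule card_Diff1_less[rotated])
    ultimately show False by simp
  qed
  with G that show ?thesis by blast
qed

text \<open>After thinning, every point is counted at most twice, so the masses of the intervals add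
  up to at most \<open>2 * measure \<mu> U\<close>. Intervals are never enlarged, hence the estimate
  survives for measures without any doubling property.\<close>

lemma finite_interval_maximal_inequality:
  fixes m \<mu> :: "real measure" and \<F> :: "(real \<times> real) set"
  assumes "finite_measure m" "finite_measure \<mu>" and sets: "sets m = sets borel" "sets \<mu> = sets borel"
    and "0 < t" "U \<in> sets borel" "finite \<F>"
    and \<F>: "\<And>p. p \<in> \<F> \<Longrightarrow> {fst p<..<snd p} \<subseteq> U"
      "\<And>p. p \<in> \<F> \<Longrightarrow> t * measure m {fst p<..<snd p} \<le> measure \<mu> {fst p<..<snd p}"
  shows "t * measure m (\<Union>p\<in>\<F>. {fst p<..<snd p}) \<le> 2 * measure \<mu> U"
proof -
  interpret m: finite_measure m by fact
  interpret \<mu>: finite_measure \<mu> by fact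
  note [simp] = sets and [measurable] = \<open>U \<in> sets borel\<close>
  let ?I = "\<lambda>p::real\<times>real. {fst p<..<snd p}"
  obtain \<G> where \<G>: "\<G> \<subseteq> \<F>" "(\<Union>p\<in>\<G>. ?I p) = (\<Union>p\<in>\<F>. ?I p)" "\<And>x. card {p\<in>\<G>. x \<in> ?I p} \<le> 2"
    using finite_interval_subcover[OF \<open>finite \<F>\<close>] by blast
  have fin: "finite \<G>" using \<G>(1) \<open>finite \<F>\<close> finite_subset by blast
  have "t * measure m (\<Union>p\<in>\<F>. ?I p) \<le> t * (\<Sum>p\<in>\<G>. measure m (?I p))"
    unfolding \<G>(2)[symmetric] using \<open>0 < t\<close> fin
    by (intro mult_left_mono m.finite_measure_subadditive_finite) auto
  also have "\<dots> \<le> (\<Sum>p\<in>\<G>. measure \<mu> (?I p))"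
    unfolding sum_distrib_left using \<F>(2) \<G>(1) by (intro sum_mono) auto
  also have "\<dots> = (\<Sum>p\<in>\<G>. (\<integral>x. indicator (?I p) x \<partial>\<mu>))"
    using sets_eq_imp_space_eq[OF sets(2)] by simp
  also have "\<dots> = (\<integral>x. (\<Sum>p\<in>\<G>. indicator (?I p) x) \<partial>\<mu>)"
    by (intro Bochner_Integration.integral_sum[symmetric]) (auto simp: less_top[symmetric])
  also have "\<dots> \<le> (\<integral>x. 2 * indicator U x \<partial>\<mu>)"
  proof (intro integral_mono)
    fix x
    have *: "(\<Sum>p\<in>\<G>. indicator (?I p) x :: real) = card {p\<in>\<G>. x \<in> ?I p}"
      using fin by (simp add: indicator_def sum.If_cases Int_def)
    show "(\<Sum>p\<in>\<G>. indicator (?I p) x) \<le> (2 * indicator U x :: real)"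
    proof (cases "x \<in> U")
      case False
      then have "{p\<in>\<G>. x \<in> ?I p} = {}" using \<F>(1) \<G>(1) by blast
      then show ?thesis unfolding * by (simp only: card.empty) simp
    qed (use \<G>(3)[of x] in \<open>simp add: *\<close>)
  qed (auto simp: less_top[symmetric])
  also have "\<dots> = 2 * measure \<mu> U" using sets_eq_imp_space_eq[OF sets(2)] by simp
  finally show ?thesis .
qed

text \<open>Lindelof's theorem extracts a countable subfamily with the same union, and finite parts
  of it exhaust that union from below.\<close>

lemma interval_maximal_inequality:
  fixes m \<mu> :: "real measure" and \<F> :: "(real \<times> real) set"
  assumes "finite_measure m" "finite_measure \<mu>" and sets: "sets m = sets borel" "sets \<mu> = sets borel"
    and "0 < t" "U \<in> sets borel"
    and \<F>: "\<And>p. p \<in> \<F> \<Longrightarrow> {fst p<..<snd p} \<subseteq> U"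
      "\<And>p. p \<in> \<F> \<Longrightarrow> t * measure m {fst p<..<snd p} \<le> measure \<mu> {fst p<..<snd p}"
  shows "t * measure m (\<Union>p\<in>\<F>. {fst p<..<snd p}) \<le> 2 * measure \<mu> U"
proof -
  interpret m: finite_measure m by fact
  let ?I = "\<lambda>p::real\<times>real. {fst p<..<snd p}"
  obtain \<H> where \<H>: "\<H> \<subseteq> ?I ` \<F>" "countable \<H>" "\<Union>\<H> = \<Union>(?I ` \<F>)"
    by (rule Lindelof[of "?I ` \<F>"]) auto
  obtain \<G> where \<G>: "\<G> \<subseteq> \<F>" "countable \<G>" "\<H> = ?I ` \<G>"
    using countable_subset_image[of \<H> ?I \<F>] \<H>(1,2) by blast
  show ?thesis
  proof (cases "\<G> = {}")
    case True
    then show ?thesis using \<H> \<G> by simp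
  next
    case False
    let ?e = "from_nat_into \<G>"
    let ?V = "\<lambda>n. (\<Union>p\<in>?e ` {..n}. ?I p)"
    have "(\<lambda>n. measure m (?V n)) \<longlonglongrightarrow> measure m (\<Union>n. ?V n)"
    proof (rule m.finite_Lim_measure_incseq)
      show "incseq ?V" by (intro monoI UN_mono image_mono) auto
    qed (auto simp: sets)
    moreover have "(\<Union>n. ?V n) = (\<Union>p\<in>\<F>. ?I p)"
    proof -
      have "(\<Union>n. ?V n) = (\<Union>p\<in>range ?e. ?I p)" by auto
      also have "range ?e = \<G>" using \<G> False by (simp add: range_from_nat_into)
      finally show ?thesis using \<H> \<G> by auto
    qed
    ultimately have "(\<lambda>n. t * measure m (?V n)) \<longlonglongrightarrow> t * measure m (\<Union>p\<in>\<F>. ?I p)"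
      by (intro tendsto_intros) auto
    moreover have "?e n \<in> \<F>" for n using from_nat_into[OF False] \<G>(1) by auto
    then have "t * measure m (?V n) \<le> 2 * measure \<mu> U" for n
      by (intro finite_interval_maximal_inequality assms \<F>) auto
    ultimately show ?thesis by (intro LIMSEQ_le_const2) auto
  qed
qed

section \<open>Differentiation along shrinking balls\<close>

lemma ball_real_interval: "ball (y::real) r = {fst (y - r, y + r)<..<snd (y - r, y + r)}"
  by (auto simp: dist_real_def)

text \<open>Outer regularity encloses \<open>A\<close> in an open \<open>U\<close> of small
  \<rho>-mass. A point of \<open>A\<close> with large ratios at arbitrarily small radii is the
  centre of a bad ball inside \<open>U\<close>, and the maximal inequality makes the union of such
  balls small for \<open>m\<close>.\<close>

lemma ball_ratio_tendsto_0:
  fixes m \<rho> :: "real measure" and r :: "nat \<Rightarrow> real"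
  assumes "finite_measure m" "finite_measure \<rho>" and sets: "sets m = sets borel" "sets \<rho> = sets borel"
    and A: "A \<in> sets borel" "emeasure \<rho> A = 0" and r: "r \<longlonglongrightarrow> 0" "\<And>n. 0 < r n"
  shows "AE y in m. y \<in> A \<longrightarrow> (\<lambda>n. measure \<rho> (ball y (r n)) / measure m (ball y (r n))) \<longlonglongrightarrow> 0"
proof -
  interpret m: finite_measure m by fact
  interpret \<rho>: finite_measure \<rho> by fact
  let ?q = "\<lambda>y n. measure \<rho> (ball y (r n)) / measure m (ball y (r n))"
  have *: "AE y in m. y \<in> A \<longrightarrow> eventually (\<lambda>n. ?q y n \<le> t) sequentially" if "t > 0" for t
  proof -
    let ?B = "{y\<in>A. \<not> eventually (\<lambda>n. ?q y n \<le> t) sequentially}"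
    have "\<exists>V. open V \<and> ?B \<subseteq> V \<and> measure m V \<le> 1 / Suc k" for k :: nat
    proof -
      \<comment> \<open>The threshold cancels the 2 and the \<open>t\<close> of the maximal
        inequality, leaving \<open>1 / Suc k\<close>.\<close>
      have "emeasure \<rho> A < ennreal (t / (2 * Suc k))" using A \<open>t > 0\<close> by simp
      then have "(INF U\<in>{U. A \<subseteq> U \<and> open U}. emeasure \<rho> U) < ennreal (t / (2 * Suc k))"
        using outer_regular[of \<rho> A] A sets \<rho>.emeasure_finite by simp
      then obtain U where U: "A \<subseteq> U" "open U" "emeasure \<rho> U < ennreal (t / (2 * Suc k))"
        by (auto simp: INF_less_iff)
      then have U3: "measure \<rho> U < t / (2 * Suc k)"
        using \<open>t > 0\<close> by (simp add: \<rho>.emeasure_eq_measure ennreal_less_iff)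
      define \<F> where "\<F> = {(y - s, y + s) | y s. ball y s \<subseteq> U \<and> t * measure m (ball y s) \<le> measure \<rho> (ball y s)}"
      let ?V = "\<Union>p\<in>\<F>. {fst p<..<snd p}"
      have "t * measure m ?V \<le> 2 * measure \<rho> U"
        by (rule interval_maximal_inequality) (use assms that U in \<open>auto simp: \<F>_def ball_real_interval\<close>)
      also have "\<dots> \<le> t / Suc k" using U3 by (simp add: field_simps)
      finally have "t * measure m ?V \<le> t * (1 / Suc k)" by simp
      then have "measure m ?V \<le> 1 / Suc k" using \<open>t > 0\<close> mult_le_cancel_left_pos by blast
      moreover have "?B \<subseteq> ?V"
      proof
        fix y assume y: "y \<in> ?B"
        then obtain e where e: "e > 0" "ball y e \<subseteq> U" using U openE by blast
        have "eventually (\<lambda>n. r n < e) sequentially" using r(1) e(1) by (rule order_tendstoD)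
        moreover have "frequently (\<lambda>n. t < ?q y n) sequentially" using y by (simp add: frequently_def not_less)
        ultimately have "frequently (\<lambda>n. t < ?q y n \<and> r n < e) sequentially"
          using frequently_eventually_frequently by blast
        then obtain n where n: "t < ?q y n" "r n < e" by (auto dest: frequently_ex)
        \<comment> \<open>A quotient by 0 is 0 by convention, so a ratio above the positive
          \<open>t\<close> has a positive denominator.\<close>
        have "measure m (ball y (r n)) > 0" using n(1) \<open>t > 0\<close>
          by (cases "measure m (ball y (r n)) = 0") (auto simp: zero_less_measure_iff)
        then have "t * measure m (ball y (r n)) \<le> measure \<rho> (ball y (r n))" using n(1) by (simp add: field_simps)
        moreover have "ball y (r n) \<subseteq> U" using n(2) e(2) by (auto simp: dist_real_def)
        ultimately have "(y - r n, y + r n) \<in> \<F>" unfolding \<F>_def by blast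
        then show "y \<in> ?V" using r(2)[of n] by (intro UN_I) auto
      qed
      moreover have "open ?V" by auto
      ultimately show ?thesis by blast
    qed
    then have "\<exists>V. \<forall>k. open (V k) \<and> ?B \<subseteq> V k \<and> measure m (V k) \<le> 1 / Suc k" by (intro choice allI)
    then obtain V where V: "\<And>k. open (V k)" "\<And>k. ?B \<subseteq> V k" "\<And>k::nat. measure m (V k) \<le> 1 / Suc k" by blast
    have [measurable]: "V k \<in> sets borel" for k using V(1) by auto
    have "measure m (\<Inter>k. V k) \<le> 1 / Suc k" for k
      by (rule order_trans[OF m.finite_measure_mono V(3)]) (auto simp: sets)
    then have "measure m (\<Inter>k. V k) \<le> 0"
      by (intro LIMSEQ_le_const[OF LIMSEQ_Suc[OF lim_1_over_n]]) auto
    then have "(\<Inter>k. V k) \<in> null_sets m"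
      by (intro null_setsI) (auto simp: m.emeasure_eq_measure sets measure_le_0_iff)
    \<comment> \<open>The exceptional set is only enclosed in a measurable null set; its own
      measurability never has to be decided.\<close>
    moreover have "{y \<in> space m. \<not> (y \<in> A \<longrightarrow> eventually (\<lambda>n. ?q y n \<le> t) sequentially)} \<subseteq> (\<Inter>k. V k)"
      using V(2) by blast
    ultimately show ?thesis by (rule AE_I')
  qed
  have "AE y in m. \<forall>k::nat. y \<in> A \<longrightarrow> eventually (\<lambda>n. ?q y n \<le> 1 / Suc k) sequentially"
    unfolding AE_all_countable using * by simp
  then show ?thesis
  proof eventually_elim
    case (elim y)
    show ?case
    proof
      assume "y \<in> A"
      show "(\<lambda>n. ?q y n) \<longlonglongrightarrow> 0"
      proof (rule order_tendstoI)
        fix a :: real assume "a < 0"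
        then have "a < ?q y n" for n by (rule less_le_trans) simp
        then show "eventually (\<lambda>n. a < ?q y n) sequentially" by simp
      next
        fix a :: real assume "0 < a"
        then obtain k :: nat where "inverse (Suc k) < a" using reals_Archimedean by blast
        then have "1 / Suc k < a" by (simp add: field_simps)
        with elim \<open>y \<in> A\<close> show "eventually (\<lambda>n. ?q y n < a) sequentially"
          by (auto elim!: allE[of _ k] eventually_mono)
      qed
    qed
  qed
qed

text \<open>The limit is the density \<open>h\<close>. The excess \<rho> \<open>q\<close> of
  \<open>\<mu>\<close> over \<open>q\<close> times \<open>m\<close> gives no mass to the points with
  \<open>h y \<le> q\<close>, so its ratio vanishes there and the ratio of \<open>\<mu>\<close> ends
  up below anything above \<open>q\<close>. The deficit \<sigma> \<open>q\<close> gives the bound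
  from below in the same way.\<close>

lemma ball_ratio_convergent:
  fixes m \<mu> :: "real measure" and r :: "nat \<Rightarrow> real"
  assumes "finite_measure m" "finite_measure \<mu>" and sets: "sets m = sets borel" "sets \<mu> = sets borel"
    and "absolutely_continuous m \<mu>" and r: "r \<longlonglongrightarrow> 0" "\<And>n. 0 < r n"
  shows "AE y in m. (\<forall>n. 0 < measure m (ball y (r n))) \<longrightarrow>
    convergent (\<lambda>n. measure \<mu> (ball y (r n)) / measure m (ball y (r n)))"
proof -
  interpret m: finite_measure m by fact
  interpret \<mu>: finite_measure \<mu> by fact
  have [measurable_cong]: "sets m = sets borel" by fact
  obtain f where f [measurable]: "f \<in> borel_measurable m" and dens: "density m f = \<mu>"
    using m.Radon_Nikodym_finite_measure[of \<mu>] assms by auto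
  have "(\<integral>\<^sup>+x. f x \<partial>m) = emeasure \<mu> (space m)"
    unfolding dens[symmetric] by (subst emeasure_density) (auto intro!: nn_integral_cong)
  then have fin: "AE x in m. f x \<noteq> \<infinity>"
    by (intro nn_integral_PInf_AE) auto
  define h where "h x = enn2real (f x)" for x
  have [measurable]: "h \<in> borel_measurable m" by (auto simp: h_def[abs_def])
  have hf: "AE x in m. ennreal (h x) = f x"
    using fin by eventually_elim (simp add: h_def less_top)
  have h0: "0 \<le> h x" for x by (simp add: h_def)
  have em: "emeasure \<mu> B = (\<integral>\<^sup>+x. ennreal (h x) * indicator B x \<partial>m)" if "B \<in> sets borel" for B
    unfolding dens[symmetric] using that hf
    by (subst emeasure_density) (auto intro!: nn_integral_cong_AE simp: sets elim!: eventually_mono)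
  have total: "(\<integral>\<^sup>+x. ennreal (h x) \<partial>m) < \<infinity>"
    using em[of UNIV] \<mu>.emeasure_finite[of UNIV] by (simp add: less_top)
  define \<rho> where "\<rho> q = density m (\<lambda>x. ennreal (h x - q))" for q
  define \<sigma> where "\<sigma> q = density m (\<lambda>x. ennreal (q - h x))" for q
  have fin\<rho>: "finite_measure (\<rho> q)" if "0 \<le> q" for q
  proof
    have "emeasure (\<rho> q) (space (\<rho> q)) \<le> (\<integral>\<^sup>+x. ennreal (h x) \<partial>m)"
      unfolding \<rho>_def using that by (simp add: emeasure_density) (auto intro!: nn_integral_mono ennreal_leI simp: indicator_def)
    then show "emeasure (\<rho> q) (space (\<rho> q)) \<noteq> \<infinity>" using total by (auto simp: top_unique)
  qed
  have fin\<sigma>: "finite_measure (\<sigma> q)" if "0 \<le> q" for q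
  proof
    have "emeasure (\<sigma> q) (space (\<sigma> q)) \<le> (\<integral>\<^sup>+x. ennreal q \<partial>m)"
      unfolding \<sigma>_def space_density by (subst emeasure_density) (auto intro!: nn_integral_mono ennreal_leI simp: indicator_def h0 simp del: nn_integral_const)
    also have "\<dots> < \<infinity>" by (simp add: m.emeasure_eq_measure ennreal_mult''[symmetric])
    finally show "emeasure (\<sigma> q) (space (\<sigma> q)) \<noteq> \<infinity>" by simp
  qed
  let ?m = "\<lambda>y n. measure m (ball y (r n))"
  have A: "AE y in m. h y \<le> q \<longrightarrow> (\<lambda>n. measure (\<rho> q) (ball y (r n)) / ?m y n) \<longlonglongrightarrow> 0" if "0 \<le> q" for q
  proof -
    have "{y. h y \<le> q} \<in> sets borel" by measurable
    moreover have "emeasure (\<rho> q) {y. h y \<le> q} = 0"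
    proof -
      show ?thesis unfolding \<rho>_def
        by (subst emeasure_density) (auto simp: nn_integral_0_iff_AE indicator_def ennreal_neg)
    qed
    ultimately have "AE y in m. y \<in> {y. h y \<le> q} \<longrightarrow> (\<lambda>n. measure (\<rho> q) (ball y (r n)) / ?m y n) \<longlonglongrightarrow> 0"
      using assms fin\<rho>[OF that] by (intro ball_ratio_tendsto_0) (auto simp: \<rho>_def)
    then show ?thesis by simp
  qed
  have B: "AE y in m. q \<le> h y \<longrightarrow> (\<lambda>n. measure (\<sigma> q) (ball y (r n)) / ?m y n) \<longlonglongrightarrow> 0" if "0 \<le> q" for q
  proof -
    have "{y. q \<le> h y} \<in> sets borel" by measurable
    moreover have "emeasure (\<sigma> q) {y. q \<le> h y} = 0"
    proof -
      show ?thesis unfolding \<sigma>_def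
        by (subst emeasure_density) (auto simp: nn_integral_0_iff_AE indicator_def ennreal_neg)
    qed
    ultimately have "AE y in m. y \<in> {y. q \<le> h y} \<longrightarrow> (\<lambda>n. measure (\<sigma> q) (ball y (r n)) / ?m y n) \<longlonglongrightarrow> 0"
      using assms fin\<sigma>[OF that] by (intro ball_ratio_tendsto_0) (auto simp: \<sigma>_def)
    then show ?thesis by simp
  qed
  have le_add_diff: "ennreal a \<le> ennreal c + ennreal (a - c)" if "0 \<le> c" for a c :: real
    using that by (cases "a \<le> c") (auto simp: ennreal_plus[symmetric] ennreal_neg intro: ennreal_leI simp del: ennreal_plus)
  have up: "measure \<mu> C \<le> q * measure m C + measure (\<rho> q) C" if "0 \<le> q" "C \<in> sets borel" for q C
  proof -
    interpret \<rho>: finite_measure "\<rho> q" by (rule fin\<rho>) fact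
    have [measurable]: "C \<in> sets m" using that by (simp add: sets)
    have "emeasure \<mu> C \<le> (\<integral>\<^sup>+x. ennreal q * indicator C x + ennreal (h x - q) * indicator C x \<partial>m)"
      unfolding em[OF that(2)] using le_add_diff[OF that(1)] by (intro nn_integral_mono) (auto simp: indicator_def)
    also have "\<dots> = ennreal q * emeasure m C + emeasure (\<rho> q) C"
      unfolding \<rho>_def by (subst nn_integral_add) (auto simp: nn_integral_cmult emeasure_density)
    finally show ?thesis using that
      by (simp add: \<mu>.emeasure_eq_measure m.emeasure_eq_measure \<rho>.emeasure_eq_measure ennreal_mult[symmetric] ennreal_plus[symmetric] del: ennreal_plus)
  qed
  have low: "q * measure m C \<le> measure \<mu> C + measure (\<sigma> q) C" if "0 \<le> q" "C \<in> sets borel" for q C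
  proof -
    interpret \<sigma>: finite_measure "\<sigma> q" by (rule fin\<sigma>) fact
    have [measurable]: "C \<in> sets m" using that by (simp add: sets)
    have "ennreal q * emeasure m C = (\<integral>\<^sup>+x. ennreal q * indicator C x \<partial>m)"
      by (simp add: nn_integral_cmult)
    also have "\<dots> \<le> (\<integral>\<^sup>+x. ennreal (h x) * indicator C x + ennreal (q - h x) * indicator C x \<partial>m)"
      using le_add_diff[OF h0] by (intro nn_integral_mono) (auto simp: indicator_def)
    also have "\<dots> = emeasure \<mu> C + emeasure (\<sigma> q) C"
      unfolding \<sigma>_def em[OF that(2)] by (subst nn_integral_add) (auto simp: emeasure_density)
    finally show ?thesis using that
      by (simp add: \<mu>.emeasure_eq_measure m.emeasure_eq_measure \<sigma>.emeasure_eq_measure ennreal_mult[symmetric] ennreal_plus[symmetric] del: ennreal_plus)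
  qed
  \<comment> \<open>Rational levels suffice to squeeze the limit and leave a single null
    set.\<close>
  have "AE y in m. \<forall>q::rat. 0 \<le> q \<longrightarrow> 
     (h y \<le> real_of_rat q \<longrightarrow> (\<lambda>n. measure (\<rho> (real_of_rat q)) (ball y (r n)) / ?m y n) \<longlonglongrightarrow> 0) \<and>
     (real_of_rat q \<le> h y \<longrightarrow> (\<lambda>n. measure (\<sigma> (real_of_rat q)) (ball y (r n)) / ?m y n) \<longlonglongrightarrow> 0)"
    unfolding AE_all_countable
  proof (rule allI, rule AE_impI)
    fix q :: rat assume "0 \<le> q"
    then have "0 \<le> real_of_rat q" by simp
    from A[OF this] B[OF this] show "AE y in m. 
     (h y \<le> real_of_rat q \<longrightarrow> (\<lambda>n. measure (\<rho> (real_of_rat q)) (ball y (r n)) / ?m y n) \<longlonglongrightarrow> 0) \<and>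
     (real_of_rat q \<le> h y \<longrightarrow> (\<lambda>n. measure (\<sigma> (real_of_rat q)) (ball y (r n)) / ?m y n) \<longlonglongrightarrow> 0)"
      by eventually_elim auto
  qed
  then show ?thesis
  proof eventually_elim
    case (elim y)
    show ?case
    proof
      assume pos: "\<forall>n. 0 < ?m y n"
      have "(\<lambda>n. measure \<mu> (ball y (r n)) / ?m y n) \<longlonglongrightarrow> h y"
      proof (rule order_tendstoI)
        fix a assume "a < h y"
        show "eventually (\<lambda>n. a < measure \<mu> (ball y (r n)) / ?m y n) sequentially"
        proof (cases "a < 0")
          case True
          have "a < measure \<mu> (ball y (r n)) / ?m y n" for n by (rule less_le_trans[OF True]) simp
          then show ?thesis by simp
        next
          case False
          obtain q where q: "a < real_of_rat q" "real_of_rat q < h y" using of_rat_dense[OF \<open>a < h y\<close>] by blast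
          with False have "0 < real_of_rat q" by linarith
          then have q0: "0 \<le> real_of_rat q" "0 \<le> q" by auto
          have "eventually (\<lambda>n. measure (\<sigma> (real_of_rat q)) (ball y (r n)) / ?m y n < real_of_rat q - a) sequentially"
            using elim q q0 by (intro order_tendstoD(2)[of _ 0]) auto
          then show ?thesis
          proof eventually_elim
            case (elim n)
            have "real_of_rat q \<le> (measure \<mu> (ball y (r n)) + measure (\<sigma> (real_of_rat q)) (ball y (r n))) / ?m y n"
              using low[OF q0(1), of "ball y (r n)"] pos by (simp add: pos_le_divide_eq)
            with elim show ?case by (simp add: add_divide_distrib)
          qed
        qed
      next
        fix a assume "h y < a"
        obtain q where q: "h y < real_of_rat q" "real_of_rat q < a" using of_rat_dense[OF \<open>h y < a\<close>] by blast
        with h0[of y] have "0 < real_of_rat q" by linarith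
        then have q0: "0 \<le> real_of_rat q" "0 \<le> q" by auto
        have "eventually (\<lambda>n. measure (\<rho> (real_of_rat q)) (ball y (r n)) / ?m y n < a - real_of_rat q) sequentially"
          using elim q q0 by (intro order_tendstoD(2)[of _ 0]) auto
        then show "eventually (\<lambda>n. measure \<mu> (ball y (r n)) / ?m y n < a) sequentially"
        proof eventually_elim
          case (elim n)
          have "measure \<mu> (ball y (r n)) / ?m y n \<le> (real_of_rat q * ?m y n + measure (\<rho> (real_of_rat q)) (ball y (r n))) / ?m y n"
            using up[OF q0(1), of "ball y (r n)"] by (intro divide_right_mono) auto
          also have "\<dots> = real_of_rat q + measure (\<rho> (real_of_rat q)) (ball y (r n)) / ?m y n"
            using pos[rule_format, of n] by (simp add: field_simps)
          finally show ?case using elim by simp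
        qed
      qed
      then show "convergent (\<lambda>n. measure \<mu> (ball y (r n)) / ?m y n)" by (rule convergentI)
    qed
  qed
qed

section \<open>Exact dimensionality\<close>

lemma borel_measurable_measure_ball:
  fixes \<mu> :: "'a::{metric_space, second_countable_topology} measure"
  assumes "finite_measure \<mu>" and sets: "sets \<mu> = sets borel"
  shows "(\<lambda>z. measure \<mu> (ball z r)) \<in> borel_measurable borel"
proof -
  interpret finite_measure \<mu> by fact
  have "open {p::'a \<times> 'a. dist (fst p) (snd p) < r}"
    by (intro open_Collect_less continuous_intros)
  then have "{p::'a \<times> 'a. dist (fst p) (snd p) < r} \<in> sets (borel \<Otimes>\<^sub>M borel)"
    unfolding borel_prod by auto
  also have "sets (borel \<Otimes>\<^sub>M borel :: ('a \<times> 'a) measure) = sets (borel \<Otimes>\<^sub>M \<mu>)"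
    by (intro sets_pair_measure_cong) (simp_all add: sets)
  finally have "(\<lambda>z. emeasure \<mu> (Pair z -` {p. dist (fst p) (snd p) < r})) \<in> borel_measurable borel"
    by (rule measurable_emeasure_Pair)
  moreover have "Pair z -` {p. dist (fst p) (snd p) < r} = ball z r" for z :: 'a by auto
  ultimately show ?thesis by (simp add: measure_def)
qed

text \<open>By monotonicity \<open>a r\<close> lies between its values at two neighbouring geometric
  radii, whose logarithms differ only by a constant.\<close>

lemma local_dimension_along_sequence:
  fixes a :: "real \<Rightarrow> real"
  assumes mono: "\<And>r s. 0 < r \<Longrightarrow> r \<le> s \<Longrightarrow> a r \<le> a s" and pos: "\<And>n. 0 < a (R * \<gamma> ^ n)"
    and R: "0 < R" and \<gamma>: "0 < \<gamma>" "\<gamma> < 1" and lim: "(\<lambda>n. - ln (a (R * \<gamma> ^ n)) / n) \<longlonglongrightarrow> h"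
  shows "((\<lambda>r. ln (a r) / ln r) \<longlongrightarrow> h / (- ln \<gamma>)) (at_right 0)"
    and "\<And>r. 0 < r \<Longrightarrow> 0 < a r"
proof -
  show apos: "0 < a r" if r: "0 < r" for r
  proof -
    obtain n where "\<gamma> ^ n < r / R" using real_arch_pow_inv[of "r / R" \<gamma>] r R \<gamma> by auto
    then have "R * \<gamma> ^ n \<le> r" using R by (simp add: field_simps)
    with mono[of "R * \<gamma> ^ n" r] pos[of n] R \<gamma> show ?thesis by simp
  qed
  define L where "L = - ln \<gamma>"
  have L: "L > 0" using \<gamma> by (simp add: L_def)
  \<comment> \<open>The real exponent at which the geometric radius equals \<open>r\<close>;
    rounding it down gives
    \<open>R * \<gamma> ^ (N r + 1) \<le> r \<le> R * \<gamma> ^ N r\<close>.\<close>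
  define t where "t r = (ln R - ln r) / L" for r
  define N where "N r = nat \<lfloor>t r\<rfloor>" for r
  have t_top: "filterlim t at_top (at_right 0)" unfolding t_def using L by real_asymp
  have N_t: "real (N r) \<le> t r \<and> t r < real (N r) + 1" if "0 \<le> t r" for r
    using that unfolding N_def by linarith
  have N_top: "filterlim N at_top (at_right 0)" unfolding filterlim_at_top
  proof
    fix Z :: nat
    have "eventually (\<lambda>r. real Z + 1 \<le> t r) (at_right 0)" using t_top by (simp add: filterlim_at_top)
    then show "eventually (\<lambda>r. Z \<le> N r) (at_right 0)"
      by eventually_elim (use N_t in \<open>smt (verit) of_nat_0_le_iff of_nat_le_iff\<close>)
  qed
  have small: "eventually (\<lambda>r::real. 0 < r \<and> r < 1 \<and> 0 \<le> t r) (at_right 0)"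
    using t_top eventually_at_right_real[of 0 1] by (auto simp: filterlim_at_top elim!: allE[of _ 0] elim: eventually_elim2)
  have tlim: "((\<lambda>r. (t r + c) / (- ln r)) \<longlongrightarrow> 1 / L) (at_right 0)" for c
  proof -
    have "((\<lambda>r. ((ln R - ln r) / L + c) / (- ln r)) \<longlongrightarrow> inverse L) (at_right 0)" using L by real_asymp
    then show ?thesis by (simp add: t_def inverse_eq_divide)
  qed
  have Nlim: "((\<lambda>r. (real (N r) + c) / (- ln r)) \<longlongrightarrow> 1 / L) (at_right 0)" for c
  proof (rule tendsto_sandwich[OF _ _ tlim[of "c - 1"] tlim[of c]])
    show "\<forall>\<^sub>F r in at_right 0. (t r + (c - 1)) / - ln r \<le> (real (N r) + c) / - ln r"
      using small
    proof eventually_elim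
      case (elim r)
      then show ?case using N_t[of r] by (intro divide_right_mono) auto
    qed
    show "\<forall>\<^sub>F r in at_right 0. (real (N r) + c) / - ln r \<le> (t r + c) / - ln r"
      using small
    proof eventually_elim
      case (elim r)
      then show ?case using N_t[of r] by (intro divide_right_mono) auto
    qed
  qed
  let ?A = "\<lambda>n. - ln (a (R * \<gamma> ^ n)) / real n"
  have comp: "((\<lambda>r. ?A (N r + c) * ((real (N r) + real c) / (- ln r))) \<longlongrightarrow> h * (1 / L)) (at_right 0)" for c :: nat
  proof (intro tendsto_mult Nlim)
    have "filterlim (\<lambda>r. N r + c) sequentially (at_right 0)"
      by (rule filterlim_at_top_mono[OF N_top]) auto
    then show "((\<lambda>r. ?A (N r + c)) \<longlongrightarrow> h) (at_right 0)"
      by (rule filterlim_compose[OF lim])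
  qed
  have *: "?A (N r + c) * ((real (N r) + real c) / (- ln r)) = ln (a (R * \<gamma> ^ (N r + c))) / ln r" if "N r + c > 0" for r c
    using that by (simp add: of_nat_add[symmetric] del: of_nat_add)
  have N1: "eventually (\<lambda>r. 1 \<le> N r) (at_right 0)" using N_top by (simp add: filterlim_at_top)
  have power_exp: "R * \<gamma> ^ n = exp (ln R - real n * L)" for n
    using R \<gamma> by (simp add: L_def exp_diff exp_minus exp_add exp_of_nat_mult exp_of_nat2_mult)
  have "((\<lambda>r. ln (a r) / ln r) \<longlongrightarrow> h * (1 / L)) (at_right 0)"
  \<comment> \<open>As \<open>ln r\<close> is negative, the larger radius (offset 0) yields the
    lower bound and the smaller one (offset 1) the upper bound.\<close>
  proof (rule tendsto_sandwich[OF _ _ comp[of 0] comp[of 1]])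
    show "\<forall>\<^sub>F r in at_right 0. ?A (N r + 0) * ((real (N r) + real 0) / - ln r) \<le> ln (a r) / ln r"
      using small N1
    proof eventually_elim
      case (elim r)
      have "ln r \<le> ln R - real (N r) * L" using N_t[of r] elim L by (simp add: t_def field_simps)
      then have "r \<le> R * \<gamma> ^ N r" unfolding power_exp using elim by (metis exp_le_cancel_iff exp_ln)
      then have "ln (a r) \<le> ln (a (R * \<gamma> ^ (N r + 0)))" using elim apos[of r] pos[of "N r"] mono[of r] by (subst ln_le_cancel_iff) auto
      then have "ln (a (R * \<gamma> ^ (N r + 0))) / ln r \<le> ln (a r) / ln r"
        using elim by (intro divide_right_mono_neg) auto
      then show ?case using elim by (subst *) auto
    qed
    show "\<forall>\<^sub>F r in at_right 0. ln (a r) / ln r \<le> ?A (N r + 1) * ((real (N r) + real 1) / - ln r)"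
      using small N1
    proof eventually_elim
      case (elim r)
      have "ln R - real (N r + 1) * L \<le> ln r" using N_t[of r] elim L by (simp add: t_def field_simps)
      then have "R * \<gamma> ^ (N r + 1) \<le> r" unfolding power_exp using elim by (metis exp_le_cancel_iff exp_ln)
      then have "ln (a (R * \<gamma> ^ (N r + 1))) \<le> ln (a r)" using elim pos[of "N r + 1"] apos[of r] mono[of "R * \<gamma> ^ (N r + 1)" r] R \<gamma>
        by (subst ln_le_cancel_iff) auto
      then have "ln (a r) / ln r \<le> ln (a (R * \<gamma> ^ (N r + 1))) / ln r"
        using elim by (intro divide_right_mono_neg) auto
      then show ?case using elim by (subst *) auto
    qed
  qed
  then show "((\<lambda>r. ln (a r) / ln r) \<longlongrightarrow> h / (- ln \<gamma>)) (at_right 0)" by (simp add: L_def)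
qed

text \<open>Transferring an almost-sure statement from \<open>M\<close> to the image measure goes
  through a measurable set of points, and a limit over a continuum of radii does not present itself
  as one. \<open>Q\<close> therefore expresses the limit along \<open>(1/2) ^ n\<close> by countably
  many conditions; monotonicity recovers the rest.\<close>

lemma exact_dimensional_distrI:
  fixes f :: "'b \<Rightarrow> 'a::{metric_space, second_countable_topology}"
  assumes "prob_space M" and f [measurable]: "f \<in> borel_measurable M"
    and lim: "AE \<omega> in M. (\<forall>r>0. 0 < measure (distr M borel f) (ball (f \<omega>) r)) \<and>
      ((\<lambda>r. ln (measure (distr M borel f) (ball (f \<omega>) r)) / ln r) \<longlongrightarrow> \<beta>) (at_right 0)"
  shows "exact_dimensional (distr M borel f) \<beta>"
proof -
  let ?\<nu> = "distr M borel f"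
  interpret \<nu>: prob_space ?\<nu> using assms(1) f by (rule prob_space.prob_space_distr)
  have [measurable]: "(\<lambda>z. measure ?\<nu> (ball z r)) \<in> borel_measurable borel" for r
    by (intro borel_measurable_measure_ball) (auto intro: \<nu>.finite_measure_axioms)
  \<comment> \<open>The factor \<open>1 *\<close> and the target \<open>\<beta> * ln 2\<close> fit
    \<open>local_dimension_along_sequence\<close> with \<open>R = 1\<close> and ratio
    \<open>1/2\<close>.\<close>
  define Q where "Q = {z::'a. (\<forall>n::nat. 0 < measure ?\<nu> (ball z (1 * (1/2) ^ n))) \<and>
    (\<forall>k::nat. \<exists>N. \<forall>n\<ge>N. \<bar>- ln (measure ?\<nu> (ball z (1 * (1/2) ^ n))) / n - \<beta> * ln 2\<bar> < 1 / Suc k)}"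
  have lim_iff: "(\<lambda>n. u n) \<longlonglongrightarrow> l \<longleftrightarrow> (\<forall>k::nat. \<exists>N. \<forall>n\<ge>N. \<bar>u n - l\<bar> < 1 / Suc k)" for u :: "nat \<Rightarrow> real" and l
  proof
    assume "u \<longlonglongrightarrow> l"
    then show "\<forall>k::nat. \<exists>N. \<forall>n\<ge>N. \<bar>u n - l\<bar> < 1 / Suc k"
      unfolding LIMSEQ_iff by simp
  next
    assume *: "\<forall>k::nat. \<exists>N. \<forall>n\<ge>N. \<bar>u n - l\<bar> < 1 / Suc k"
    show "u \<longlonglongrightarrow> l"
    proof (rule LIMSEQ_I)
      fix e :: real assume "0 < e"
      then obtain k :: nat where k: "inverse (Suc k) < e" using reals_Archimedean by blast
      obtain N where N: "\<forall>n\<ge>N. \<bar>u n - l\<bar> < 1 / Suc k" using * by blast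
      have "norm (u n - l) < e" if "n \<ge> N" for n
        using k N[rule_format, OF that] by (simp add: inverse_eq_divide)
      then show "\<exists>N. \<forall>n\<ge>N. norm (u n - l) < e" by blast
    qed
  qed
  have "Q \<in> sets borel" unfolding Q_def by measurable
  moreover have "AE \<omega> in M. f \<omega> \<in> Q"
    using lim
  proof eventually_elim
    case (elim \<omega>)
    let ?a = "\<lambda>r. measure ?\<nu> (ball (f \<omega>) r)"
    have "filterlim (\<lambda>n. (1/2::real) ^ n) (at_right 0) sequentially" by real_asymp
    from filterlim_compose[OF elim[THEN conjunct2] this]
    have "(\<lambda>n. ln (?a ((1/2) ^ n)) / ln ((1/2) ^ n) * ln 2) \<longlonglongrightarrow> \<beta> * ln 2" by (intro tendsto_intros)
    moreover have "ln (?a ((1/2) ^ n)) / ln ((1/2) ^ n) * ln 2 = - ln (?a (1 * (1/2) ^ n)) / n" for n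
      by (simp add: ln_realpow ln_div)
    ultimately show ?case using elim unfolding Q_def lim_iff by simp
  qed
  ultimately have "AE z in ?\<nu>. z \<in> Q" by (subst AE_distr_iff) auto
  then show ?thesis unfolding exact_dimensional_def
  proof eventually_elim
    case (elim z)
    then have "(\<lambda>n. - ln (measure ?\<nu> (ball z (1 * (1/2) ^ n))) / n) \<longlonglongrightarrow> \<beta> * ln 2"
      unfolding Q_def lim_iff by blast
    then have "((\<lambda>r. ln (measure ?\<nu> (ball z r)) / ln r) \<longlongrightarrow> \<beta> * ln 2 / (- ln (1/2))) (at_right 0)"
      using elim by (intro local_dimension_along_sequence(1)[where R=1]) (auto simp: Q_def intro!: \<nu>.finite_measure_mono)
    then show ?case by (simp add: ln_div)
  qed
qed

text \<open>The balls whose Lebesgue mass in a bounded window is at least \<open>t\<close> times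
  their \<open>m\<close>-mass cannot cover \<open>m\<close>-almost everything. Some typical centre
  is left over, and there the mass of the ball is at least a constant times \<open>r\<close> for all
  \<open>r < 1\<close>.\<close>

lemma exact_dimensional_real_le_1:
  fixes m :: "real measure"
  assumes "prob_space m" and sets: "sets m = sets borel" and dim: "exact_dimensional m \<beta>"
    and supp: "AE y in m. \<bar>y\<bar> \<le> R"
  shows "\<beta> \<le> 1"
proof -
  interpret m: prob_space m by fact
  have [simp]: "space m = UNIV" using sets_eq_imp_space_eq[OF sets] by simp
  \<comment> \<open>One unit of margin keeps balls of radius below 1 around points of the support
    inside the window.\<close>
  define R' where "R' = \<bar>R\<bar> + 1"
  define \<mu> where "\<mu> = density lborel (indicator {-R'..R'})"
  have emu: "emeasure \<mu> B = emeasure lborel ({-R'..R'} \<inter> B)" if "B \<in> sets borel" for B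
    using that unfolding \<mu>_def by (simp add: emeasure_restricted)
  interpret \<mu>: finite_measure \<mu>
  proof
    have "emeasure \<mu> (space \<mu>) = emeasure lborel {-R'..R'}" using emu[of UNIV] by (simp add: \<mu>_def)
    also have "\<dots> = ennreal (2 * R')" by (simp add: R'_def)
    finally show "emeasure \<mu> (space \<mu>) \<noteq> \<infinity>" by simp
  qed
  \<comment> \<open>The window has length \<open>2 * R'\<close>, so the maximal inequality has
    \<open>4 * R'\<close> on its right side; a larger \<open>t\<close> forces
    \<open>measure m ?V < 1\<close>.\<close>
  define t where "t = 4 * R' + 1"
  have t: "t > 0" by (simp add: t_def R'_def)
  define \<F> where "\<F> = {(y - s, y + s) | y s. t * measure m (ball y s) \<le> measure \<mu> (ball y s)}"
  let ?V = "\<Union>p\<in>\<F>. {fst p<..<snd p}"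
  have "t * measure m ?V \<le> 2 * measure \<mu> UNIV"
  proof (rule interval_maximal_inequality)
    fix p assume "p \<in> \<F>"
    then show "t * measure m {fst p<..<snd p} \<le> measure \<mu> {fst p<..<snd p}"
      by (auto simp: \<F>_def ball_real_interval)
  qed (use m.finite_measure_axioms \<mu>.finite_measure_axioms sets t in \<open>simp_all add: \<mu>_def\<close>)
  also have "measure \<mu> UNIV = 2 * R'" using emu[of UNIV] by (simp add: measure_def R'_def)
  finally have "t * measure m ?V < t * 1" by (simp add: t_def)
  then have "measure m ?V < 1" using t mult_less_cancel_left_pos by blast
  moreover have V: "?V \<in> sets m" unfolding sets by (intro borel_open) auto
  ultimately have "\<not> (AE y in m. y \<in> ?V)" using m.prob_eq_1[OF V] by simp
  have "\<not> (AE y in m. \<not> (y \<notin> ?V \<and> \<bar>y\<bar> \<le> R \<and> ((\<lambda>r. ln (measure m (ball y r)) / ln r) \<longlongrightarrow> \<beta>) (at_right 0)))"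
  proof
    assume "AE y in m. \<not> (y \<notin> ?V \<and> \<bar>y\<bar> \<le> R \<and> ((\<lambda>r. ln (measure m (ball y r)) / ln r) \<longlongrightarrow> \<beta>) (at_right 0))"
    with supp dim[unfolded exact_dimensional_def] have "AE y in m. y \<in> ?V" by eventually_elim auto
    with \<open>\<not> (AE y in m. y \<in> ?V)\<close> show False ..
  qed
  then obtain y where y: "y \<notin> ?V" "\<bar>y\<bar> \<le> R" and lim: "((\<lambda>r. ln (measure m (ball y r)) / ln r) \<longlongrightarrow> \<beta>) (at_right 0)"
    by (metis (mono_tags, lifting) AE_I2)
  have bound: "2 * r / t < measure m (ball y r)" if "0 < r" "r < 1" for r
  proof -
    have "(y - r, y + r) \<notin> \<F>"
    proof
      assume "(y - r, y + r) \<in> \<F>"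
      then have "y \<in> ?V" using that by (intro UN_I) auto
      with y(1) show False ..
    qed
    then have "measure \<mu> (ball y r) < t * measure m (ball y r)" unfolding \<F>_def by force
    moreover have "{-R'..R'} \<inter> ball y r = {y - r<..<y + r}" using y(2) that by (auto simp: R'_def dist_real_def)
    then have "measure \<mu> (ball y r) = 2 * r" using emu[of "ball y r"] that by (simp add: measure_def)
    ultimately show ?thesis using t by (simp add: field_simps)
  qed
  have "((\<lambda>r. (ln 2 - ln t + ln r) / ln r) \<longlongrightarrow> 1) (at_right 0)" by real_asymp
  then show "\<beta> \<le> 1"
  proof (rule tendsto_le[OF _ _ lim, rotated])
    show "\<forall>\<^sub>F r in at_right 0. ln (measure m (ball y r)) / ln r \<le> (ln 2 - ln t + ln r) / ln r"
      using eventually_at_right_real[of 0 1, OF zero_less_one]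
    proof eventually_elim
      case (elim r)
      then have "ln (2 * r / t) \<le> ln (measure m (ball y r))"
        using bound[of r] t by (intro ln_mono) (auto intro: less_imp_le order_less_trans[rotated])
      then have "ln 2 - ln t + ln r \<le> ln (measure m (ball y r))" using elim t by (simp add: ln_div ln_mult)
      then show ?case using elim by (intro divide_right_mono_neg) auto
    qed
  qed simp
qed

lemma local_dimension_rescale:
  fixes a :: "real \<Rightarrow> real"
  assumes "((\<lambda>r. ln (a r) / ln r) \<longlongrightarrow> \<alpha>) (at_right 0)" and "0 < c"
  shows "((\<lambda>r. ln (a (c * r)) / ln r) \<longlongrightarrow> \<alpha>) (at_right 0)"
proof -
  have "filterlim (\<lambda>r. c * r) (at_right 0) (at_right 0)" using \<open>0 < c\<close> by real_asymp
  from filterlim_compose[OF assms(1) this]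
  have "((\<lambda>r. ln (a (c * r)) / ln (c * r)) \<longlongrightarrow> \<alpha>) (at_right 0)" .
  moreover have "((\<lambda>r. ln (c * r) / ln r) \<longlongrightarrow> 1) (at_right 0)" using \<open>0 < c\<close> by real_asymp
  ultimately have "((\<lambda>r. ln (a (c * r)) / ln (c * r) * (ln (c * r) / ln r)) \<longlongrightarrow> \<alpha> * 1) (at_right 0)"
    by (rule tendsto_mult)
  moreover have "eventually (\<lambda>r. ln (a (c * r)) / ln (c * r) * (ln (c * r) / ln r) = ln (a (c * r)) / ln r) (at_right 0)"
  proof -
    have "eventually (\<lambda>r. ln (c * r) < 0) (at_right 0)" using \<open>0 < c\<close> by real_asymp
    then show ?thesis by eventually_elim simp
  qed
  ultimately show ?thesis by (simp add: Lim_transform_eventually)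
qed

section \<open>Ergodicity of the digit shift\<close>

text \<open>The approximable sets are closed under complements, because the symmetric difference
  does not change, and under countable unions: a finite partial union loses less than
  \<open>e / 2\<close>, and finite unions add up the errors of their members.\<close>

lemma (in prob_space) algebra_approximation:
  assumes alg: "algebra (space M) \<A>" and sub: "\<A> \<subseteq> events"
    and B: "B \<in> sigma_sets (space M) \<A>" and "0 < e"
  shows "\<exists>A\<in>\<A>. prob ((A - B) \<union> (B - A)) < e"
proof -
  interpret \<A>: algebra "space M" \<A> by fact
  show ?thesis using B \<open>0 < e\<close>
  proof (induction arbitrary: e)
    case (Basic a)
    then show ?case by (intro bexI[of _ a]) auto
  next
    case Empty
    then show ?case using \<A>.empty_sets by (intro bexI[of _ "{}"]) auto
  next
    case (Compl a)
    obtain A where A: "A \<in> \<A>" "prob ((A - a) \<union> (a - A)) < e" using Compl by blast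
    have "A \<subseteq> space M" using \<A>.space_closed A(1) by blast
    moreover have "a \<subseteq> space M" using sigma_sets_into_sp[OF \<A>.space_closed Compl.hyps] by blast
    ultimately have "((space M - A) - (space M - a)) \<union> ((space M - a) - (space M - A)) = (A - a) \<union> (a - A)" by auto
    with A show ?case using \<A>.compl_sets[OF A(1)] by (intro bexI[of _ "space M - A"]) auto
  next
    case (Union a)
    have ev: "a i \<in> events" for i
      using Union.hyps sets.sigma_sets_subset[OF sub] by blast
    have Aev: "A \<in> events" if "A \<in> \<A>" for A using that sub by blast
    have fin: "\<exists>A\<in>\<A>. prob ((A - (\<Union>i<n. a i)) \<union> ((\<Union>i<n. a i) - A)) < e" if "0 < e" for n e
      using that
    proof (induction n arbitrary: e)
      case 0
      then show ?case using \<A>.empty_sets by (intro bexI[of _ "{}"]) auto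
    next
      case (Suc n)
      let ?V = "\<Union>i<n. a i"
      obtain A where A: "A \<in> \<A>" "prob ((A - ?V) \<union> (?V - A)) < e / 2" using Suc.IH[of "e/2"] Suc.prems by auto
      obtain A' where A': "A' \<in> \<A>" "prob ((A' - a n) \<union> (a n - A')) < e / 2" using Union.IH[of "e/2" n] Suc.prems by auto
      have "prob ((A \<union> A' - (\<Union>i<Suc n. a i)) \<union> ((\<Union>i<Suc n. a i) - (A \<union> A')))
          \<le> prob (((A - ?V) \<union> (?V - A)) \<union> ((A' - a n) \<union> (a n - A')))"
        using ev Aev[OF A(1)] Aev[OF A'(1)] by (intro finite_measure_mono) (auto simp: lessThan_Suc)
      also have "\<dots> \<le> prob ((A - ?V) \<union> (?V - A)) + prob ((A' - a n) \<union> (a n - A'))"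
        using ev Aev[OF A(1)] Aev[OF A'(1)] by (intro measure_Un_le) auto
      also have "\<dots> < e" using A A' by simp
      finally show ?case using \<A>.Un[OF A(1) A'(1)] by blast
    qed
    let ?W = "\<Union>i. a i"
    have "(\<lambda>n. prob (\<Union>i<n. a i)) \<longlonglongrightarrow> prob (\<Union>n. \<Union>i<n. a i)"
      using ev by (intro finite_Lim_measure_incseq incseq_SucI UN_mono) auto
    moreover have "(\<Union>n. \<Union>i<n. a i) = ?W" by auto
    ultimately have "eventually (\<lambda>n. prob ?W - e / 2 < prob (\<Union>i<n. a i)) sequentially"
      using Union.prems by (intro order_tendstoD(1)) auto
    then obtain n where n: "prob ?W - e / 2 < prob (\<Union>i<n. a i)" by (auto simp: eventually_sequentially)
    let ?V = "\<Union>i<n. a i"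
    have "prob (?W - ?V) = prob ?W - prob ?V"
      using ev by (intro finite_measure_Diff) auto
    then have WV: "prob (?W - ?V) < e / 2" using n by simp
    obtain A where A: "A \<in> \<A>" "prob ((A - ?V) \<union> (?V - A)) < e / 2" using fin[of "e/2" n] Union.prems by auto
    have "prob ((A - ?W) \<union> (?W - A)) \<le> prob (((A - ?V) \<union> (?V - A)) \<union> (?W - ?V))"
      using ev Aev[OF A(1)] by (intro finite_measure_mono) auto
    also have "\<dots> \<le> prob ((A - ?V) \<union> (?V - A)) + prob (?W - ?V)"
      using ev Aev[OF A(1)] by (intro measure_Un_le) auto
    also have "\<dots> < e" using A WV by simp
    finally show ?case using A(1) by blast
  qed
qed

section \<open>The digit shift and its invariant measure\<close>

locale digit_system =
  fixes b :: nat
  assumes b_ge_2: "b \<ge> 2"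
begin

lemma prob_space_digit: "prob_space (uniform_count_measure {0..<b})"
  using b_ge_2 by (intro prob_space_uniform_count_measure) auto

sublocale seq: sequence_space "uniform_count_measure {0..<b}"
  using prob_space_digit
  by (auto simp: sequence_space_def product_prob_space_def product_prob_space_axioms_def product_sigma_finite_def
      intro: prob_space_imp_sigma_finite)

abbreviation "D \<equiv> digit_measure b"
abbreviation "\<U> \<equiv> uniform_measure lborel {0..<1::real}"

definition shift :: "(nat \<Rightarrow> nat) \<Rightarrow> nat \<Rightarrow> nat" where "shift j = (\<lambda>k. j (Suc k))"

text \<open>For \<open>x\<close> in the unit interval this moves the first entry of \<open>j\<close>
  to the front of the base-\<open>b\<close> expansion of \<open>x\<close>. The pair is a two-sided
  digit sequence, with \<open>x\<close> storing the past.\<close>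

definition F :: "real \<times> (nat \<Rightarrow> nat) \<Rightarrow> real \<times> (nat \<Rightarrow> nat)" where
  "F p = ((fst p + real (snd p 0)) / real b, shift (snd p))"

sublocale D: prob_space "digit_measure b"
  unfolding digit_measure_def by (rule seq.P.prob_space_axioms)

sublocale U: prob_space "uniform_measure lborel {0..<1::real}"
  by (rule prob_space_uniform_measure) auto

sublocale UD: pair_prob_space "uniform_measure lborel {0..<1::real}" "digit_measure b" ..

abbreviation "P \<equiv> \<U> \<Otimes>\<^sub>M D"

lemma space_D: "space D = {j. \<forall>k. j k < b}"
  by (auto simp: digit_measure_def space_PiM space_uniform_count_measure PiE_def Pi_def)

lemma space_P: "space P = UNIV \<times> space D"
  by (simp add: space_pair_measure)

lemma digit_measurable: "(\<lambda>j. j k) \<in> measurable D (count_space {0..<b})"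
proof -
  have "(\<lambda>j. j k) \<in> measurable D (uniform_count_measure {0..<b})"
    unfolding digit_measure_def by (rule measurable_component_singleton) auto
  then show ?thesis
    by (simp add: measurable_cong_sets[OF refl sets_uniform_count_measure_count_space])
qed

lemma digit_real_measurable [measurable]: "(\<lambda>j. real (j k)) \<in> borel_measurable D"
  using measurable_compose[OF digit_measurable, of real borel k] by simp

lemma digit_pred_measurable [measurable]: "Measurable.pred D (\<lambda>j. j k = i)"
proof -
  have "Measurable.pred D (\<lambda>j. real (j k) = real i)" by measurable
  then show ?thesis by simp
qed

lemma shift_measurable [measurable]: "shift \<in> measurable D D"
  unfolding digit_measure_def shift_def
  by (rule measurable_PiM_single')
     (auto simp: space_PiM PiE_def Pi_def intro!: measurable_component_singleton)

lemma measurable_U_iff: "measurable N \<U> = borel_measurable N"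
  by (rule measurable_cong_sets) simp_all

lemma F_measurable [measurable]: "F \<in> measurable P P"
proof -
  have [measurable]: "(\<lambda>p. real (snd p 0)) \<in> borel_measurable P"
    using measurable_compose[OF measurable_snd digit_real_measurable] .
  have [measurable]: "fst \<in> borel_measurable P"
    using measurable_fst[of \<U> D] by (simp only: measurable_U_iff)
  have "(\<lambda>p. (fst p + real (snd p 0)) / real b) \<in> measurable P \<U>"
    unfolding measurable_U_iff by (intro borel_measurable_divide borel_measurable_add) simp_all
  then show ?thesis unfolding F_def
    by (intro measurable_Pair measurable_compose[OF measurable_snd shift_measurable])
qed

text \<open>\<open>D\<close> is also the law of a uniform digit put in front of an independent
  \<open>D\<close>-distributed sequence; under this description the set becomes a rectangle.\<close>

lemma emeasure_digit_cylinder: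
  assumes "i < b" and B [measurable]: "B \<in> sets D"
  shows "emeasure D {j\<in>space D. j 0 = i \<and> shift j \<in> B} = emeasure D B / ennreal (real b)"
proof -
  let ?N = "uniform_count_measure {0..<b}"
  interpret N: prob_space ?N by (rule prob_space_digit)
  have iter: "distr (?N \<Otimes>\<^sub>M D) D (\<lambda>(s, \<omega>). case_nat s \<omega>) = D"
    using seq.PiM_iter unfolding digit_measure_def .
  have m: "(\<lambda>(s, \<omega>). case_nat s \<omega>) \<in> measurable (?N \<Otimes>\<^sub>M D) D"
    unfolding digit_measure_def by measurable
  have "emeasure D {j\<in>space D. j 0 = i \<and> shift j \<in> B}
      = emeasure (distr (?N \<Otimes>\<^sub>M D) D (\<lambda>(s, \<omega>). case_nat s \<omega>)) {j\<in>space D. j 0 = i \<and> shift j \<in> B}"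
    by (simp only: iter)
  also have "\<dots> = emeasure (?N \<Otimes>\<^sub>M D) ((\<lambda>(s, \<omega>). case_nat s \<omega>) -` {j\<in>space D. j 0 = i \<and> shift j \<in> B} \<inter> space (?N \<Otimes>\<^sub>M D))"
    by (intro emeasure_distr m) measurable
  also have "(\<lambda>(s, \<omega>). case_nat s \<omega>) -` {j\<in>space D. j 0 = i \<and> shift j \<in> B} \<inter> space (?N \<Otimes>\<^sub>M D) = {i} \<times> B"
    using sets.sets_into_space[OF B] \<open>i < b\<close>
    by (auto simp: space_pair_measure space_uniform_count_measure shift_def space_D split: nat.splits)
  also have "emeasure (?N \<Otimes>\<^sub>M D) ({i} \<times> B) = emeasure ?N {i} * emeasure D B"
    using \<open>i < b\<close> by (intro D.emeasure_pair_measure_Times) (auto simp: sets_uniform_count_measure)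
  also have "emeasure ?N {i} = ennreal (1 / real b)"
    using \<open>i < b\<close> by (simp add: emeasure_uniform_count_measure)
  finally show ?thesis using b_ge_2
    by (simp add: divide_ennreal_def inverse_ennreal mult.commute divide_inverse)
qed

lemma emeasure_U: "A \<in> sets borel \<Longrightarrow> emeasure \<U> A = emeasure lborel ({0..<1} \<inter> A)"
  by (simp add: divide_ennreal_def)

lemma emeasure_U_branch:
  assumes [measurable]: "A \<in> sets borel"
  shows "emeasure \<U> {x. (x + real i) / real b \<in> A} = ennreal (real b) * emeasure lborel ({real i / b..<(real i + 1) / b} \<inter> A)"
proof -
  let ?X = "{real i / b..<(real i + 1) / b} \<inter> A"
  have b0: "real b > 0" using b_ge_2 by simp
  have "emeasure lborel ?X = (\<integral>\<^sup>+x. indicator ?X x \<partial>lborel)" by simp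
  also have "\<dots> = ennreal (1 / b) * (\<integral>\<^sup>+x. indicator ?X (real i / b + 1 / b * x) \<partial>lborel)"
    using b0 by (subst nn_integral_real_affine[of _ "1 / b" "real i / b"]) auto
  also have "(\<integral>\<^sup>+x. indicator ?X (real i / b + 1 / b * x) \<partial>lborel) = (\<integral>\<^sup>+x. indicator ({0..<1} \<inter> {x. (x + real i) / real b \<in> A}) x \<partial>lborel)"
  proof (intro nn_integral_cong)
    fix x :: real
    have "real i / b + 1 / b * x = (x + real i) / b" by (simp add: add_divide_distrib)
    moreover have "(x + real i) / b \<in> {real i / b..<(real i + 1) / b} \<longleftrightarrow> x \<in> {0..<1}"
      using b0 by (auto simp: divide_le_cancel divide_less_cancel)
    ultimately show "indicator ?X (real i / b + 1 / b * x) = (indicator ({0..<1} \<inter> {x. (x + real i) / real b \<in> A}) x :: ennreal)"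
      by (auto simp: indicator_def)
  qed
  also have "\<dots> = emeasure \<U> {x. (x + real i) / real b \<in> A}"
    by (subst emeasure_U) auto
  finally have "ennreal (real b) * emeasure lborel ?X = (ennreal b * ennreal (1 / b)) * emeasure \<U> {x. (x + real i) / real b \<in> A}"
    by (simp add: mult.assoc)
  also have "ennreal b * ennreal (1 / b) = 1" using b0 by (simp add: ennreal_mult''[symmetric])
  finally show ?thesis by simp
qed

lemma unit_interval_partition: "(\<Union>i<b. {real i / b..<(real i + 1) / b}) = {0..<1}"
proof -
  have b0: "real b > 0" using b_ge_2 by simp
  have "\<exists>i<b. x \<in> {real i / b..<(real i + 1) / b}" if "0 \<le> x" "x < 1" for x :: real
  proof (intro exI conjI)
    have "real b * x < real b * 1" using that b0 by (intro mult_strict_left_mono) auto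
    then have "\<lfloor>b * x\<rfloor> < int b" by linarith
    moreover have f0: "0 \<le> \<lfloor>b * x\<rfloor>" using that by simp
    ultimately show "nat \<lfloor>b * x\<rfloor> < b" by linarith
    have "real (nat \<lfloor>b * x\<rfloor>) \<le> b * x" "b * x < real (nat \<lfloor>b * x\<rfloor>) + 1" using f0 by linarith+
    then show "x \<in> {real (nat \<lfloor>b * x\<rfloor>) / b..<(real (nat \<lfloor>b * x\<rfloor>) + 1) / b}"
      using b0 by (simp add: field_simps)
  qed
  moreover have "0 \<le> x \<and> x < 1" if "i < b" "x \<in> {real i / b..<(real i + 1) / b}" for i and x :: real
  proof -
    have "(real i + 1) / b \<le> 1" using that(1) b0 by (simp add: divide_le_eq)
    moreover have "0 \<le> real i / b" by simp
    ultimately show ?thesis using that(2) by (simp only: atLeastLessThan_iff) linarith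
  qed
  ultimately show ?thesis by (intro set_eqI) (auto simp: Bex_def)
qed

text \<open>It suffices to test rectangles. The preimage splits according to the first digit; the
  factor \<open>b\<close> from the inverse branch cancels the probability \<open>1 / b\<close> of
  the digit, and the images of the branches tile the unit interval.\<close>

lemma distr_F: "distr P P F = P"
proof (rule sym, rule pair_measure_eqI)
  show "sigma_finite_measure \<U>" "sigma_finite_measure D" by unfold_locales
  fix A B assume "A \<in> sets \<U>" and B [measurable]: "B \<in> sets D"
  then have A [measurable]: "A \<in> sets borel" by simp
  have b0: "real b > 0" using b_ge_2 by simp
  let ?A = "\<lambda>i. {x. (x + real i) / real b \<in> A}" and ?B = "\<lambda>i. {j\<in>space D. j 0 = i \<and> shift j \<in> B}"
  have AB: "A \<times> B \<in> sets P" by auto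
  have sA: "?A i \<in> sets \<U>" and sB: "?B i \<in> sets D" for i by auto
  have "emeasure (distr P P F) (A \<times> B) = emeasure P (F -` (A \<times> B) \<inter> space P)"
    by (intro emeasure_distr AB) simp
  also have "F -` (A \<times> B) \<inter> space P = (\<Union>i<b. ?A i \<times> ?B i)"
    using sets.sets_into_space[OF B] by (auto simp: space_P F_def space_D)
  also have "emeasure P \<dots> = (\<Sum>i<b. emeasure P (?A i \<times> ?B i))"
    using sA sB by (intro sum_emeasure[symmetric]) (auto simp: disjoint_family_on_def)
  also have "\<dots> = (\<Sum>i<b. emeasure lborel ({real i / b..<(real i + 1) / b} \<inter> A) * emeasure D B)"
  proof (intro sum.cong refl)
    fix i assume i: "i \<in> {..<b}"
    have "emeasure P (?A i \<times> ?B i) = emeasure \<U> (?A i) * emeasure D (?B i)"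
      by (intro D.emeasure_pair_measure_Times sA sB)
    also have "\<dots> = ennreal (real b) * emeasure lborel ({real i / b..<(real i + 1) / b} \<inter> A) * (emeasure D B / ennreal (real b))"
      using i by (simp only: emeasure_U_branch[OF A] emeasure_digit_cylinder[OF _ B] lessThan_iff)
    also have "\<dots> = (ennreal b * (1 / ennreal b)) * (emeasure lborel ({real i / b..<(real i + 1) / b} \<inter> A) * emeasure D B)"
      by (simp add: divide_ennreal_def mult_ac)
    also have "ennreal b * (1 / ennreal b) = 1" using b0 by (simp add: ennreal_times_divide)
    finally show "emeasure P (?A i \<times> ?B i) = emeasure lborel ({real i / b..<(real i + 1) / b} \<inter> A) * emeasure D B" by simp
  qed
  also have "\<dots> = (\<Sum>i<b. emeasure lborel ({real i / b..<(real i + 1) / b} \<inter> A)) * emeasure D B"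
    by (simp add: sum_distrib_right)
  also have "(\<Sum>i<b. emeasure lborel ({real i / b..<(real i + 1) / b} \<inter> A)) = emeasure lborel (\<Union>i<b. {real i / b..<(real i + 1) / b} \<inter> A)"
  proof (rule sum_emeasure)
    have "real i < real k + 1 \<Longrightarrow> real k < real i + 1 \<Longrightarrow> i = k" for i k :: nat by linarith
    moreover have "{real i / b..<(real i + 1) / b} \<inter> {real k / b..<(real k + 1) / b} \<noteq> {} \<Longrightarrow> real i < real k + 1 \<and> real k < real i + 1" for i k
      using b0 by (auto simp: field_simps) 
    ultimately show "disjoint_family_on (\<lambda>i. {real i / b..<(real i + 1) / b} \<inter> A) {..<b}"
      unfolding disjoint_family_on_def by blast
  qed auto
  also have "(\<Union>i<b. {real i / b..<(real i + 1) / b} \<inter> A) = {0..<1} \<inter> A"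
    using unit_interval_partition by blast
  also have "emeasure lborel \<dots> = emeasure \<U> A" by (rule emeasure_U[OF A, symmetric])
  finally show "emeasure \<U> A * emeasure D B = emeasure (distr P P F) (A \<times> B)" by simp
qed simp

sublocale mp: measure_preserving P F
  by (intro measure_preserving.intro measure_preserving_axioms.intro UD.prob_space_axioms F_measurable distr_F)

text \<open>These are the measurable sets depending on a central window of the two-sided digit
  sequence. The floor records the first \<open>k\<close> digits of \<open>x\<close> together with
  its integer part, since the first coordinate ranges over the whole line. One implication is
  enough, as the condition is symmetric in the two points.\<close>

definition cylindrical :: "nat \<Rightarrow> (real \<times> (nat \<Rightarrow> nat)) set \<Rightarrow> bool" where
  "cylindrical k A \<longleftrightarrow> A \<in> sets P \<and>
     (\<forall>x j x' j'. j \<in> space D \<longrightarrow> j' \<in> space D \<longrightarrow> \<lfloor>real b ^ k * x\<rfloor> = \<lfloor>real b ^ k * x'\<rfloor> \<longrightarrow>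
        (\<forall>i<k. j i = j' i) \<longrightarrow> (x, j) \<in> A \<longrightarrow> (x', j') \<in> A)"

lemma cylindrical_iff:
  assumes "cylindrical k A" "j \<in> space D" "j' \<in> space D" "\<lfloor>real b ^ k * x\<rfloor> = \<lfloor>real b ^ k * x'\<rfloor>" "\<And>i. i < k \<Longrightarrow> j i = j' i"
  shows "(x, j) \<in> A \<longleftrightarrow> (x', j') \<in> A"
  using assms unfolding cylindrical_def by metis

lemma floor_power_mono:
  assumes "k \<le> l" "\<lfloor>real b ^ l * x\<rfloor> = \<lfloor>real b ^ l * x'\<rfloor>"
  shows "\<lfloor>real b ^ k * x\<rfloor> = \<lfloor>real b ^ k * x'\<rfloor>"
proof -
  have "\<lfloor>real b ^ k * y\<rfloor> = \<lfloor>real b ^ l * y\<rfloor> div int (b ^ (l - k))" for y :: real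
  proof -
    have "real b ^ l = real b ^ k * real b ^ (l - k)" using assms(1) by (simp flip: power_add)
    then have "real b ^ k * y = real b ^ l * y / real (b ^ (l - k))" using b_ge_2 by simp
    then show ?thesis using floor_divide_real_eq_div[of "int (b ^ (l - k))" "real b ^ l * y"]
      by (simp only: of_int_of_nat_eq of_nat_0_le_iff simp_thms)
  qed
  then show ?thesis using assms(2) by simp
qed

lemma cylindrical_mono: "k \<le> l \<Longrightarrow> cylindrical k A \<Longrightarrow> cylindrical l A"
  unfolding cylindrical_def using floor_power_mono by (meson less_le_trans)

lemma algebra_cylindrical: "algebra (space P) {A. \<exists>k. cylindrical k A}"
  unfolding algebra_iff_Un
proof (intro conjI ballI subsetI)
  fix A assume "A \<in> {A. \<exists>k. cylindrical k A}"
  then show "A \<in> Pow (space P)" using sets.sets_into_space unfolding cylindrical_def by blast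
next
  show "{} \<in> {A. \<exists>k. cylindrical k A}" by (auto simp: cylindrical_def)
next
  fix A assume "A \<in> {A. \<exists>k. cylindrical k A}"
  then obtain k where k: "cylindrical k A" by blast
  then have "cylindrical k (space P - A)"
    unfolding cylindrical_def[of k "space P - A"]
  proof (intro conjI allI impI)
    show "space P - A \<in> sets P" using k unfolding cylindrical_def by blast
    fix x j x' j'
    assume *: "j \<in> space D" "j' \<in> space D" "\<lfloor>real b ^ k * x\<rfloor> = \<lfloor>real b ^ k * x'\<rfloor>" "\<forall>i<k. j i = j' i"
      and "(x, j) \<in> space P - A"
    then show "(x', j') \<in> space P - A"
      using cylindrical_iff[OF k *(1-3), THEN iffD2] * by (auto simp: space_P)
  qed
  then show "space P - A \<in> {A. \<exists>k. cylindrical k A}" by blast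
next
  fix A B assume "A \<in> {A. \<exists>k. cylindrical k A}" "B \<in> {A. \<exists>k. cylindrical k A}"
  then obtain k l where "cylindrical k A" "cylindrical l B" by blast
  then have "cylindrical (max k l) A" "cylindrical (max k l) B"
    using cylindrical_mono by (meson max.cobounded1, meson max.cobounded2)
  then have "cylindrical (max k l) (A \<union> B)" unfolding cylindrical_def by blast
  then show "A \<union> B \<in> {A. \<exists>k. cylindrical k A}" by blast
qed

text \<open>Both coordinates are measurable for the generated sigma-algebra, so the identity is a
  measurable map from it to \<open>P\<close>.\<close>

lemma sets_P_cylindrical: "sets P \<subseteq> sigma_sets (space P) {A. \<exists>k. cylindrical k A}"
proof -
  let ?G = "{A. \<exists>k. cylindrical k A}"
  let ?N = "sigma (space P) ?G"
  have G: "?G \<subseteq> Pow (space P)" using sets.sets_into_space unfolding cylindrical_def by blast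
  have sp: "space ?N = space P" using G by simp
  have fstN: "fst \<in> borel_measurable ?N"
  proof (rule borel_measurableI_less)
    fix t :: real
    \<comment> \<open>The half-line left of \<open>t\<close> is exhausted by the
      \<open>b\<close>-adic intervals of level \<open>k\<close> whose right end is at most
      \<open>t\<close>.\<close>
    let ?A = "\<lambda>k. {p \<in> space P. (of_int \<lfloor>real b ^ k * fst p\<rfloor> + 1) / real b ^ k \<le> t}"
    have "cylindrical k (?A k)" for k
    proof -
      have [measurable]: "fst \<in> borel_measurable P"
        using measurable_fst[of \<U> D] by (simp only: measurable_U_iff)
      have "?A k \<in> sets P" by measurable
      then show ?thesis by (auto simp: cylindrical_def space_P)
    qed
    then have "?A k \<in> sets ?N" for k using G by (auto simp: sets_measure_of)
    then have "(\<Union>k. ?A k) \<in> sets ?N" by blast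
    also have "(\<Union>k. ?A k) = {p \<in> space ?N. fst p < t}"
    proof -
      have "(\<exists>k. (of_int \<lfloor>real b ^ k * x\<rfloor> + 1) / real b ^ k \<le> t) \<longleftrightarrow> x < t" for x :: real
      proof
        assume "\<exists>k. (of_int \<lfloor>real b ^ k * x\<rfloor> + 1) / real b ^ k \<le> t"
        then obtain k where k: "(of_int \<lfloor>real b ^ k * x\<rfloor> + 1) / real b ^ k \<le> t" ..
        have "x = real b ^ k * x / real b ^ k" using b_ge_2 by simp
        also have "\<dots> < (of_int \<lfloor>real b ^ k * x\<rfloor> + 1) / real b ^ k"
          using b_ge_2 by (intro divide_strict_right_mono) (linarith, simp)
        finally show "x < t" using k by simp
      next
        assume "x < t"
        then obtain k where k: "(1 / real b) ^ k < t - x"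
          using real_arch_pow_inv[of "t - x" "1 / real b"] b_ge_2 by auto
        have "(of_int \<lfloor>real b ^ k * x\<rfloor> + 1) / real b ^ k \<le> (real b ^ k * x + 1) / real b ^ k"
          by (intro divide_right_mono) auto
        also have "\<dots> = x + (1 / real b) ^ k" using b_ge_2 by (simp add: field_simps)
        finally show "\<exists>k. (of_int \<lfloor>real b ^ k * x\<rfloor> + 1) / real b ^ k \<le> t" using k by (intro exI[of _ k]) simp
      qed
      then show ?thesis unfolding sp by auto
    qed
    finally show "{p \<in> space ?N. fst p < t} \<in> sets ?N" .
  qed
  have coord: "(\<lambda>p. snd p i) \<in> measurable ?N (uniform_count_measure {0..<b})" for i
  proof -
    have "(\<lambda>p. snd p i) -` A \<inter> space ?N \<in> sets ?N" for A
    proof -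
      have eq: "(\<lambda>p. snd p i) -` A \<inter> space P = {p \<in> space P. snd p i \<in> A}" by auto
      have "(\<lambda>p. snd p i) \<in> measurable P (count_space {0..<b})"
        using measurable_compose[OF measurable_snd digit_measurable] .
      from measurable_sets[OF this, of "A \<inter> {0..<b}"]
      have "{p \<in> space P. snd p i \<in> A} \<in> sets P"
        by (rule back_subst[of "\<lambda>X. X \<in> sets P"]) (auto simp: space_P space_D)
      then have "cylindrical (Suc i) ((\<lambda>p. snd p i) -` A \<inter> space P)"
        unfolding eq cylindrical_def by (auto simp: space_P)
      then show ?thesis unfolding sp using G by (auto simp: sets_measure_of)
    qed
    then show ?thesis
    proof (intro measurableI)
      fix p assume "p \<in> space ?N"
      then show "snd p i \<in> space (uniform_count_measure {0..<b})"
        unfolding sp by (auto simp: space_P space_D space_uniform_count_measure)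
    qed
  qed
  have "(\<lambda>p i. snd p i) \<in> space ?N \<rightarrow> (\<Pi>\<^sub>E i\<in>UNIV. space (uniform_count_measure {0..<b}))"
    unfolding sp by (auto simp: space_P space_D space_uniform_count_measure)
  from measurable_PiM_single'[OF coord this] have sndN: "snd \<in> measurable ?N D"
    unfolding digit_measure_def by simp
  have "(\<lambda>p. (fst p, snd p)) \<in> measurable ?N P"
    using fstN sndN by (intro measurable_Pair) (simp only: measurable_U_iff)
  then have id: "(\<lambda>p. p) \<in> measurable ?N P" by simp
  show ?thesis
  proof
    fix A assume A: "A \<in> sets P"
    from measurable_sets[OF id A] have "A \<inter> space ?N \<in> sets ?N" by simp
    moreover have "A \<inter> space ?N = A" using sets.sets_into_space[OF A] sp by auto
    ultimately show "A \<in> sigma_sets (space P) ?G" using G by (simp add: sets_measure_of)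
  qed
qed

section \<open>Independence of distant cylinder sets and ergodicity\<close>

lemma F_funpow: "(F ^^ n) (x, j) = ((x + (\<Sum>i<n. real (j i) * real b ^ i)) / real b ^ n, \<lambda>i. j (i + n))"
proof (induction n)
  case (Suc n)
  have "(x + (\<Sum>i<n. real (j i) * real b ^ i)) / real b ^ n + real (j n) = (x + (\<Sum>i<Suc n. real (j i) * real b ^ i)) / real b ^ n"
    using b_ge_2 by (simp add: field_simps)
  moreover have "(F ^^ Suc n) (x, j) = F ((F ^^ n) (x, j))" by simp
  ultimately show ?case unfolding Suc F_def shift_def by simp
qed simp

lemma digit_sum_less:
  assumes "\<And>i. j i < b" shows "(\<Sum>i<k. real (j i) * real b ^ i) + 1 \<le> real b ^ k"
proof (induction k)
  case (Suc k)
  have "real (j k) + 1 \<le> real b" using assms[of k] by linarith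
  then have "(real (j k) + 1) * real b ^ k \<le> real b * real b ^ k" by (intro mult_right_mono) auto
  with Suc show ?case by (simp add: algebra_simps)
qed simp

text \<open>After \<open>2 * k\<close> steps the first \<open>k\<close> digits of the first
  coordinate are the entries of \<open>j\<close> with indices from \<open>k\<close> to
  \<open>2 * k - 1\<close>; \<open>x\<close> and the first \<open>k\<close> entries have been pushed
  further back. This is why independence is sought at time \<open>2 * k\<close> and not at time
  \<open>k\<close>.\<close>

lemma floor_F_funpow:
  assumes x: "0 \<le> x" "x < 1" and j: "j \<in> space D"
  shows "\<lfloor>real b ^ k * fst ((F ^^ (2 * k)) (x, j))\<rfloor> = int (\<Sum>i<k. j (i + k) * b ^ i)"
proof -
  have bk: "real b ^ k > 0" using b_ge_2 by simp
  let ?s = "\<Sum>i<k. real (j i) * real b ^ i"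
  have "(\<Sum>i<2 * k. real (j i) * real b ^ i) = ?s + (\<Sum>i=k..<2*k. real (j i) * real b ^ i)"
    by (simp add: lessThan_atLeast0 sum.atLeastLessThan_concat)
  also have "(\<Sum>i=k..<2*k. real (j i) * real b ^ i) = (\<Sum>i=0+k..<k+k. real (j i) * real b ^ i)" by (simp add: mult_2)
  also have "\<dots> = (\<Sum>i<k. real (j (i + k)) * real b ^ (i + k))"
    unfolding sum.shift_bounds_nat_ivl by (simp add: lessThan_atLeast0)
  also have "\<dots> = real b ^ k * real (\<Sum>i<k. j (i + k) * b ^ i)"
    by (simp add: sum_distrib_left power_add mult_ac)
  finally have "real b ^ k * fst ((F ^^ (2 * k)) (x, j)) = (x + ?s) / real b ^ k + real (\<Sum>i<k. j (i + k) * b ^ i)"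
    using bk unfolding F_funpow mult_2 power_add fst_conv by (simp add: field_simps)
  moreover have "?s + 1 \<le> real b ^ k" using j by (intro digit_sum_less) (auto simp: space_D)
  moreover have "0 \<le> ?s" by (intro sum_nonneg) auto
  ultimately show ?thesis using x bk
    by (intro floor_unique) (auto simp: divide_less_eq)
qed

lemma AE_U_unit: "AE x in \<U>. 0 \<le> x \<and> x < 1"
  by (rule AE_uniform_measureI) auto

text \<open>The factor \<open>c\<close> depends on \<open>B\<close> alone and serves every
  \<open>A\<close>, so it can be identified later by testing the whole space.\<close>

lemma cylindrical_independent_aux:
  assumes B: "cylindrical k B"
  obtains c where "\<And>A. cylindrical k A \<Longrightarrow> emeasure P (A \<inter> (F ^^ (2 * k)) -` B) = emeasure P A * c"
proof -
  have Bs [measurable]: "B \<in> sets P" using B by (simp add: cylindrical_def)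
  have Fm: "(F ^^ (2 * k)) \<in> measurable P P" by (rule mp.funpow_measurable)
  have z: "(\<lambda>_. 0) \<in> space D" using b_ge_2 by (simp add: space_D)
  have comb: "comb_seq k j j' \<in> space D" if "j \<in> space D" "j' \<in> space D" for j j'
    using that by (auto simp: space_D comb_seq_def)
  have combm: "(\<lambda>(j, j'). comb_seq k j j') \<in> measurable (D \<Otimes>\<^sub>M D) D"
    unfolding digit_measure_def by (rule measurable_comb_seq)
  \<comment> \<open>Within the unit interval, membership in \<open>B\<close> at time
    \<open>2 * k\<close> depends only on the entries from index \<open>k\<close> on; the point
    \<open>0\<close> with a zero prefix decides it for all others.\<close>
  define C where "C = {j' \<in> space D. (F ^^ (2 * k)) (0, comb_seq k (\<lambda>_. 0) j') \<in> B}"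
  have Cs: "C \<in> sets D"
  proof -
    have "(\<lambda>j'. ((\<lambda>_. 0), j')) \<in> measurable D (D \<Otimes>\<^sub>M D)" using z by (intro measurable_Pair) auto
    from measurable_compose[OF this combm] have "(\<lambda>j'. (0, comb_seq k (\<lambda>_. 0) j')) \<in> measurable D P"
      by (intro measurable_Pair) auto
    from measurable_compose[OF this Fm] have "(\<lambda>j'. (F ^^ (2 * k)) (0, comb_seq k (\<lambda>_. 0) j')) -` B \<inter> space D \<in> sets D"
      by (rule measurable_sets) (rule Bs)
    then show ?thesis unfolding C_def by (simp add: vimage_def Int_def conj_commute)
  qed
  have memC: "(F ^^ (2 * k)) (x, comb_seq k j j') \<in> B \<longleftrightarrow> j' \<in> C"
    if "0 \<le> x" "x < 1" "j \<in> space D" "j' \<in> space D" for x j j'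
  proof -
    have *: "(F ^^ (2 * k)) (x, comb_seq k j j') \<in> B \<longleftrightarrow> (F ^^ (2 * k)) (0, comb_seq k (\<lambda>_. 0) j') \<in> B"
    proof -
      let ?p = "(F ^^ (2 * k)) (x, comb_seq k j j')" and ?q = "(F ^^ (2 * k)) (0, comb_seq k (\<lambda>_. 0) j')"
      have "(fst ?p, snd ?p) \<in> B \<longleftrightarrow> (fst ?q, snd ?q) \<in> B"
      proof (rule cylindrical_iff[OF B])
        show "snd ?p \<in> space D" "snd ?q \<in> space D"
          using comb[OF that(3,4)] comb[OF z that(4)] by (auto simp: F_funpow space_D)
        show "\<lfloor>real b ^ k * fst ?p\<rfloor> = \<lfloor>real b ^ k * fst ?q\<rfloor>"
          using floor_F_funpow[OF that(1,2) comb[OF that(3,4)]] floor_F_funpow[OF _ _ comb[OF z that(4)], of 0]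
          by (simp add: comb_seq_add)
        show "snd ?p i = snd ?q i" for i
          by (simp add: F_funpow comb_seq_def)
      qed
      then show ?thesis by simp
    qed
    then show ?thesis using that by (simp add: C_def)
  qed
  show thesis
  proof (rule that)
    fix A assume A: "cylindrical k A"
    then have As [measurable]: "A \<in> sets P" by (simp add: cylindrical_def)
    let ?X = "A \<inter> (F ^^ (2 * k)) -` B"
    have "?X = A \<inter> ((F ^^ (2 * k)) -` B \<inter> space P)" using sets.sets_into_space[OF As] by auto
    also have "\<dots> \<in> sets P" by measurable
    finally have Xs: "?X \<in> sets P" .
    have "emeasure P ?X = (\<integral>\<^sup>+x. emeasure D (Pair x -` ?X) \<partial>\<U>)"
      by (intro D.emeasure_pair_measure_alt Xs)
    also have "\<dots> = (\<integral>\<^sup>+x. emeasure D (Pair x -` A) * emeasure D C \<partial>\<U>)"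
    proof (intro nn_integral_cong_AE)
      show "AE x in \<U>. emeasure D (Pair x -` ?X) = emeasure D (Pair x -` A) * emeasure D C"
        using AE_U_unit
      proof eventually_elim
        case (elim x)
        have Ax: "Pair x -` A \<in> sets D" "Pair x -` ?X \<in> sets D" using sets_Pair1[OF As] sets_Pair1[OF Xs] by auto
        \<comment> \<open>\<open>D\<close> is the law of \<open>k\<close> entries of one sequence
          followed by an independent second one. \<open>A\<close> sees only the first,
          \<open>B\<close> at time \<open>2 * k\<close> only the second.\<close>
        have "emeasure D (Pair x -` ?X) = emeasure (distr (D \<Otimes>\<^sub>M D) D (\<lambda>(j, j'). comb_seq k j j')) (Pair x -` ?X)"
          using seq.PiM_comb_seq[of k] unfolding digit_measure_def by simp
        also have "\<dots> = emeasure (D \<Otimes>\<^sub>M D) ((\<lambda>(j, j'). comb_seq k j j') -` (Pair x -` ?X) \<inter> space (D \<Otimes>\<^sub>M D))"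
          by (intro emeasure_distr combm Ax)
        also have "(\<lambda>(j, j'). comb_seq k j j') -` (Pair x -` ?X) \<inter> space (D \<Otimes>\<^sub>M D) = (Pair x -` A) \<times> C"
        proof -
          have "(x, comb_seq k j j') \<in> A \<longleftrightarrow> (x, j) \<in> A" if "j \<in> space D" "j' \<in> space D" for j j'
            using that comb by (intro cylindrical_iff[OF A]) (auto simp: comb_seq_less)
          moreover have "(x, j) \<in> A \<Longrightarrow> j \<in> space D" for j using sets.sets_into_space[OF As] by (auto simp: space_P)
          moreover have "C \<subseteq> space D" by (auto simp: C_def)
          moreover have "(F ^^ (2 * k)) (x, comb_seq k j j') \<in> B \<longleftrightarrow> j' \<in> C" if "j \<in> space D" "j' \<in> space D" for j j'
            using memC elim that by blast
          ultimately show ?thesis by (intro set_eqI) (force simp: space_pair_measure)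
        qed
        also have "emeasure (D \<Otimes>\<^sub>M D) ((Pair x -` A) \<times> C) = emeasure D (Pair x -` A) * emeasure D C"
          by (intro D.emeasure_pair_measure_Times Ax Cs)
        finally show ?case .
      qed
    qed
    also have "\<dots> = (\<integral>\<^sup>+x. emeasure D (Pair x -` A) \<partial>\<U>) * emeasure D C"
      by (intro nn_integral_multc D.measurable_emeasure_Pair As)
    also have "(\<integral>\<^sup>+x. emeasure D (Pair x -` A) \<partial>\<U>) = emeasure P A"
      by (intro D.emeasure_pair_measure_alt[symmetric] As)
    finally show "emeasure P ?X = emeasure P A * emeasure D C" .
  qed
qed



lemma measure_F_funpow: "A \<in> sets P \<Longrightarrow> measure P ((F ^^ n) -` A \<inter> space P) = measure P A"
  using measure_distr[OF mp.funpow_measurable, of A n] by (simp only: mp.distr_funpow)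

lemma cylindrical_independent:
  assumes A: "cylindrical k A"
  shows "measure P (A \<inter> (F ^^ (2 * k)) -` A) = measure P A * measure P A"
proof -
  obtain c where c: "\<And>B. cylindrical k B \<Longrightarrow> emeasure P (B \<inter> (F ^^ (2 * k)) -` A) = emeasure P B * c"
    using cylindrical_independent_aux[OF A] by metis
  have As: "A \<in> sets P" using A by (simp add: cylindrical_def)
  have "cylindrical k (space P)" by (auto simp: cylindrical_def space_P[symmetric]) (auto simp: space_P)
  \<comment> \<open>The whole space reveals \<open>c\<close>, which is the measure of
    \<open>A\<close> by invariance.\<close>
  from c[OF this] have "c = emeasure P (space P \<inter> (F ^^ (2 * k)) -` A)" by (simp add: UD.emeasure_space_1)
  also have "\<dots> = emeasure P A"
    using measure_F_funpow[OF As, of "2 * k"] by (simp add: UD.emeasure_eq_measure Int_commute)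
  finally show ?thesis using c[OF A] by (simp add: measure_def enn2real_mult)
qed

text \<open>An invariant set equals the intersection with its preimage at any time, whereas for an
  approximating cylinder set that intersection has the square of the measure at time
  \<open>2 * k\<close>. In the limit the measure of \<open>A\<close> equals its square.\<close>

lemma F_ergodic:
  assumes A: "A \<in> sets P" and inv: "F -` A \<inter> space P = A"
  shows "measure P A = 0 \<or> measure P A = 1"
proof -
  have invn: "(F ^^ n) -` A \<inter> space P = A" for n
  proof (induction n)
    case (Suc n)
    have "(F ^^ Suc n) -` A \<inter> space P = (F ^^ n) -` (F -` A \<inter> space P) \<inter> space P"
      using measurable_space[OF mp.funpow_measurable, of _ n] by auto
    then show ?case by (simp only: inv Suc)
  qed (use sets.sets_into_space[OF A] in auto)
  \<comment> \<open>Comparing the intersections costs \<open>2 * e\<close>, one \<open>e\<close> for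
    the set and one for its preimage; comparing the squares costs another \<open>2 * e\<close>,
    since the two masses sum to at most 2.\<close>
  have le: "\<bar>measure P A - measure P A * measure P A\<bar> \<le> 4 * e" if e0: "0 < e" for e
  proof -
    obtain C k where C: "cylindrical k C" and e: "measure P ((C - A) \<union> (A - C)) < e"
    proof -
      have "{A. \<exists>k. cylindrical k A} \<subseteq> sets P" by (auto simp: cylindrical_def)
      moreover have "A \<in> sigma_sets (space P) {A. \<exists>k. cylindrical k A}" using sets_P_cylindrical A by blast
      ultimately have "\<exists>C\<in>{A. \<exists>k. cylindrical k A}. measure P ((C - A) \<union> (A - C)) < e"
        by (intro UD.algebra_approximation[OF algebra_cylindrical] e0)
      then show ?thesis using that by blast
    qed
    have Cs: "C \<in> sets P" using C by (simp add: cylindrical_def)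
    let ?T = "\<lambda>X. (F ^^ (2 * k)) -` X \<inter> space P"
    let ?S = "(C - A) \<union> (A - C)"
    have Ss: "?S \<in> sets P" using A Cs by auto
    have Ts: "?T X \<in> sets P" if "X \<in> sets P" for X using that by measurable
    have tri: "\<bar>measure P X - measure P Y\<bar> \<le> measure P ((X - Y) \<union> (Y - X))" if "X \<in> sets P" "Y \<in> sets P" for X Y
    proof -
      have *: "measure P X \<le> measure P Y + measure P ((X - Y) \<union> (Y - X))" if "X \<in> sets P" "Y \<in> sets P" for X Y
      proof -
        have "measure P X \<le> measure P (Y \<union> ((X - Y) \<union> (Y - X)))" using that by (intro UD.finite_measure_mono) auto
        also have "\<dots> \<le> measure P Y + measure P ((X - Y) \<union> (Y - X))" using that by (intro measure_Un_le) auto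
        finally show ?thesis .
      qed
      show ?thesis using *[OF that] *[OF that(2,1)] by (simp add: Un_commute abs_le_iff)
    qed
    have 1: "\<bar>measure P C - measure P A\<bar> < e" using tri[OF Cs A] e by simp
    have "\<bar>measure P (C \<inter> ?T C) - measure P (A \<inter> ?T A)\<bar> \<le> measure P (((C \<inter> ?T C) - (A \<inter> ?T A)) \<union> ((A \<inter> ?T A) - (C \<inter> ?T C)))"
      using A Cs Ts by (intro tri) auto
    also have "\<dots> \<le> measure P (?S \<union> ?T ?S)"
      using Ss Ts[OF Ss] by (intro UD.finite_measure_mono) auto
    also have "\<dots> \<le> measure P ?S + measure P (?T ?S)" using Ss Ts[OF Ss] by (intro measure_Un_le) auto
    also have "\<dots> < 2 * e" using e measure_F_funpow[OF Ss, of "2 * k"] by simp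
    finally have 2: "\<bar>measure P (C \<inter> ?T C) - measure P (A \<inter> ?T A)\<bar> < 2 * e" .
    have "C \<inter> ?T C = C \<inter> (F ^^ (2 * k)) -` C" using sets.sets_into_space[OF Cs] by auto
    then have 3: "measure P (C \<inter> ?T C) = measure P C * measure P C" using cylindrical_independent[OF C] by simp
    have 4: "measure P (A \<inter> ?T A) = measure P A" by (simp only: invn Int_absorb)
    have "\<bar>measure P C * measure P C - measure P A * measure P A\<bar> = \<bar>measure P C - measure P A\<bar> * (measure P C + measure P A)"
      unfolding square_diff_square_factored abs_mult by simp
    also have "\<dots> \<le> e * 2"
    proof (intro mult_mono)
      show "measure P C + measure P A \<le> 2" using UD.prob_le_1[of C] UD.prob_le_1[of A] by linarith
    qed (use 1 that in auto)
    finally show ?thesis using 2 3 4 by linarith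
  qed
  have "\<bar>measure P A - measure P A * measure P A\<bar> \<le> 0"
  proof (rule field_le_epsilon)
    fix e :: real assume "0 < e"
    then show "\<bar>measure P A - measure P A * measure P A\<bar> \<le> 0 + e" using le[of "e / 4"] by linarith
  qed
  then have "measure P A - measure P A * measure P A = 0" by linarith
  then have "measure P A * (1 - measure P A) = 0" by (simp only: right_diff_distrib mult_1_right)
  then show ?thesis by auto
qed

sublocale erg: ergodic_system P F
  by (intro ergodic_system.intro ergodic_system_axioms.intro mp.measure_preserving_axioms F_ergodic)

end

section \<open>The skew product\<close>

text \<open>The sum counts the naturals below \<open>g\<close>, that is, it rounds \<open>g\<close>
  up. Integrated, it turns tail bounds at integer levels into integrability.\<close>

lemma ennreal_le_count_less: "g \<le> (\<Sum>k::nat. if of_nat k < g then 1 else 0)" for g :: ennreal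
proof (rule ccontr)
  let ?h = "\<lambda>k::nat. if of_nat k < g then 1 else 0 :: ennreal"
  assume "\<not> ?thesis"
  then have less: "(\<Sum>k. ?h k) < g" by simp
  then have "(\<Sum>k. ?h k) \<noteq> \<top>" by (auto simp: top_unique)
  then obtain x where x: "0 \<le> x" "(\<Sum>k. ?h k) = ennreal x" by (cases "\<Sum>k. ?h k") auto
  define N where "N = nat \<lfloor>x\<rfloor>"
  have "of_nat k < g" if "k \<le> N" for k
  proof -
    have "real k \<le> x" using that x(1) unfolding N_def by linarith
    then have "of_nat k \<le> ennreal x" by (simp add: ennreal_of_nat_eq_real_of_nat ennreal_leI)
    also have "\<dots> < g" using less x(2) by simp
    finally show ?thesis .
  qed
  then have "(\<Sum>k<Suc N. ?h k) = of_nat (Suc N)" by (simp add: sum.If_cases Int_absorb1 subset_eq)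
  moreover have "(\<Sum>k<Suc N. ?h k) \<le> (\<Sum>k. ?h k)" by (intro sum_le_suminf) auto
  ultimately have "ennreal (real (Suc N)) \<le> ennreal x" using x by (simp only: ennreal_of_nat_eq_real_of_nat)
  then have "real (Suc N) \<le> x" using x(1) by (simp add: ennreal_le_iff del: of_nat_Suc)
  then show False unfolding N_def by linarith
qed

section \<open>The fibre function\<close>

locale skew_product = digit_system b for b :: nat +
  fixes \<gamma> :: real and \<phi> :: "real \<Rightarrow> real" and C :: real
  assumes \<gamma>: "0 < \<gamma>" "\<gamma> < 1"
    and periodic: "\<And>x. \<phi> (x + 1) = \<phi> x"
    and lipschitz: "C-lipschitz_on UNIV \<phi>"
begin

abbreviation S :: "real \<Rightarrow> (nat \<Rightarrow> nat) \<Rightarrow> real" where "S \<equiv> S_fun b \<gamma> \<phi>"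
abbreviation m :: "real \<Rightarrow> real measure" where "m \<equiv> m_meas b \<gamma> \<phi>"

definition K :: real where "K = \<bar>\<phi> 0\<bar> + C"
text \<open>Exceeds the distance of any two values of \<open>S\<close>, so a ball of this radius
  around a value has full mass and the recursion over scales starts at mass 1. The extra 1 makes the
  inequality strict, as open balls require.\<close>

definition R :: real where "R = 2 * (K / (1 - \<gamma>)) + 1"

lemma C_nonneg: "0 \<le> C" using lipschitz by (rule lipschitz_on_nonneg)

lemma phi_lipschitz: "\<bar>\<phi> x - \<phi> y\<bar> \<le> C * \<bar>x - y\<bar>"
  using lipschitz_onD[OF lipschitz, of x y] by (simp add: dist_real_def)

lemma phi_bounded: "\<bar>\<phi> x\<bar> \<le> K"
proof -
  have n: "\<phi> (y + real n) = \<phi> y" for y n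
  proof (induction n)
    case (Suc n)
    have "\<phi> (y + real (Suc n)) = \<phi> ((y + real n) + 1)" by (simp add: algebra_simps)
    then show ?case by (simp only: periodic Suc)
  qed simp
  have "\<phi> x = \<phi> (frac x)"
  proof (cases "0 \<le> \<lfloor>x\<rfloor>")
    case True
    then have "x = frac x + real (nat \<lfloor>x\<rfloor>)" by (simp add: frac_def)
    then show ?thesis using n by metis
  next
    case False
    then have "frac x = x + real (nat (- \<lfloor>x\<rfloor>))" by (simp add: frac_def)
    then show ?thesis using n by metis
  qed
  moreover have "\<bar>\<phi> (frac x) - \<phi> 0\<bar> \<le> C * 1"
    by (rule order_trans[OF phi_lipschitz mult_left_mono]) (use C_nonneg frac_lt_1[of x] in auto)
  ultimately show ?thesis by (simp add: K_def) 
qed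

lemma K_nonneg: "0 \<le> K" using C_nonneg by (simp add: K_def)

lemma R_pos: "0 < R" using K_nonneg \<gamma> by (simp add: R_def add_nonneg_pos)

lemma S_term_bound: "norm (\<gamma> ^ n * \<phi> y) \<le> \<gamma> ^ n * K"
  using \<gamma> phi_bounded[of y] by (simp add: abs_mult mult_left_mono)

lemma S_summable: "summable (\<lambda>n. \<gamma> ^ n * \<phi> (y n))"
  by (rule summable_comparison_test'[of "\<lambda>n. \<gamma> ^ n * K" 0])
     (use \<gamma> S_term_bound in \<open>auto intro!: summable_mult2 summable_geometric\<close>)

lemma S_bounded: "\<bar>S x j\<bar> \<le> K / (1 - \<gamma>)"
proof -
  have "norm (S x j) \<le> (\<Sum>n. \<gamma> ^ n * K)" unfolding S_fun_def
    by (rule norm_suminf_le) (use \<gamma> S_term_bound in \<open>auto intro!: summable_mult2 summable_geometric\<close>)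
  also have "\<dots> = K / (1 - \<gamma>)"
    using \<gamma> by (simp add: suminf_mult2[symmetric] summable_geometric suminf_geometric)
  finally show ?thesis by simp
qed

lemma S_dist_less: "dist (S x j) (S x' j') < R"
  using S_bounded[of x j] S_bounded[of x' j'] by (simp add: R_def dist_real_def)

lemma S_rec: "S x j = \<phi> ((x + real (j 0)) / real b) + \<gamma> * S ((x + real (j 0)) / real b) (shift j)"
proof -
  let ?x = "(x + real (j 0)) / real b"
  have b0: "real b \<noteq> 0" using b_ge_2 by simp
  have arg: "(x + (\<Sum>k\<le>Suc n. real (j k) * real b ^ k)) / real b ^ (Suc n + 1) =
      (?x + (\<Sum>k\<le>n. real (shift j k) * real b ^ k)) / real b ^ (n + 1)" for n
  proof -
    have "(\<Sum>k\<le>Suc n. real (j k) * real b ^ k) = real (j 0) + real b * (\<Sum>k\<le>n. real (shift j k) * real b ^ k)"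
      by (subst sum.atMost_Suc_shift) (simp add: shift_def sum_distrib_left mult_ac)
    then have "x + (\<Sum>k\<le>Suc n. real (j k) * real b ^ k) = real b * (?x + (\<Sum>k\<le>n. real (shift j k) * real b ^ k))"
      using b0 by (simp add: field_simps del: sum.atMost_Suc)
    then show ?thesis using b0 by simp
  qed
  have "S x j = \<phi> ?x + (\<Sum>n. \<gamma> ^ Suc n * \<phi> ((x + (\<Sum>k\<le>Suc n. real (j k) * real b ^ k)) / real b ^ (Suc n + 1)))"
    unfolding S_fun_def by (subst suminf_split_head[OF S_summable]) simp
  also have "(\<Sum>n. \<gamma> ^ Suc n * \<phi> ((x + (\<Sum>k\<le>Suc n. real (j k) * real b ^ k)) / real b ^ (Suc n + 1))) = \<gamma> * S ?x (shift j)"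
    unfolding S_fun_def arg by (subst suminf_mult[OF S_summable, symmetric]) (simp add: mult_ac)
  finally show ?thesis .
qed

definition L :: real where "L = C / (1 - \<gamma>)"

lemma L_nonneg: "0 \<le> L" using C_nonneg \<gamma> by (simp add: L_def)

text \<open>Each argument of \<open>\<phi>\<close> moves by at most the displacement of
  \<open>x\<close>, because division by a power of \<open>b\<close> only shrinks; the weights then
  sum geometrically.\<close>

lemma S_lipschitz: "\<bar>S x j - S x' j\<bar> \<le> L * \<bar>x - x'\<bar>"
proof -
  let ?a = "\<lambda>x n. (x + (\<Sum>k\<le>n. real (j k) * real b ^ k)) / real b ^ (n + 1)"
  have "S x j - S x' j = (\<Sum>n. \<gamma> ^ n * \<phi> (?a x n) - \<gamma> ^ n * \<phi> (?a x' n))"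
    unfolding S_fun_def by (rule suminf_diff[OF S_summable S_summable])
  also have "norm \<dots> \<le> (\<Sum>n. \<gamma> ^ n * (C * \<bar>x - x'\<bar>))"
  proof (rule norm_suminf_le)
    fix n
    have "1 \<le> real b ^ (n + 1)" using b_ge_2 by (intro one_le_power) simp
    then have "\<bar>?a x n - ?a x' n\<bar> \<le> \<bar>x - x'\<bar>"
      by (simp add: diff_divide_distrib[symmetric] abs_divide divide_le_eq mult_left_le)
        (simp add: mult_le_cancel_left1)
    then have "C * \<bar>?a x n - ?a x' n\<bar> \<le> C * \<bar>x - x'\<bar>" using C_nonneg by (rule mult_left_mono)
    with phi_lipschitz[of "?a x n" "?a x' n"] have "\<bar>\<phi> (?a x n) - \<phi> (?a x' n)\<bar> \<le> C * \<bar>x - x'\<bar>" by linarith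
    then show "norm (\<gamma> ^ n * \<phi> (?a x n) - \<gamma> ^ n * \<phi> (?a x' n)) \<le> \<gamma> ^ n * (C * \<bar>x - x'\<bar>)"
      using \<gamma> by (simp add: right_diff_distrib[symmetric] abs_mult mult_left_mono)
  qed (use \<gamma> in \<open>auto intro!: summable_mult2 summable_geometric\<close>)
  also have "\<dots> = L * \<bar>x - x'\<bar>"
    using \<gamma> by (simp add: suminf_mult2[symmetric] summable_geometric suminf_geometric L_def)
  finally show ?thesis by simp
qed

lemma S_measurable [measurable (raw)]:
  assumes [measurable]: "f \<in> borel_measurable N" and g: "g \<in> measurable N D"
  shows "(\<lambda>z. S (f z) (g z)) \<in> borel_measurable N"
proof -
  have [measurable]: "\<phi> \<in> borel_measurable borel"
    using lipschitz_on_continuous_on[OF lipschitz] by (rule borel_measurable_continuous_onI)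
  have [measurable]: "(\<lambda>z. real (g z k)) \<in> borel_measurable N" for k
    using measurable_compose[OF g digit_real_measurable] .
  show ?thesis unfolding S_fun_def by measurable
qed

lemma fst_P_measurable [measurable]: "fst \<in> borel_measurable P"
  using measurable_fst[of \<U> D] by (simp only: measurable_U_iff)

lemma Sx_measurable [measurable]: "S x \<in> borel_measurable D"
  using S_measurable[of "\<lambda>_. x" D "\<lambda>j. j"] by simp

lemma S_P_measurable [measurable]: "(\<lambda>\<omega>. S (fst \<omega>) (snd \<omega>)) \<in> borel_measurable P"
  by (rule S_measurable[OF fst_P_measurable measurable_snd])

section \<open>Fibre measures, branches and the information of one digit\<close>

lemma prob_space_m: "prob_space (m x)"
  unfolding m_meas_def by (rule D.prob_space_distr) simp

lemma sets_m [simp]: "sets (m x) = sets borel"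
  by (simp add: m_meas_def)

lemma emeasure_m: "B \<in> sets borel \<Longrightarrow> emeasure (m x) B = emeasure D {j\<in>space D. S x j \<in> B}"
  unfolding m_meas_def by (subst emeasure_distr) (auto intro!: arg_cong2[where f=emeasure])

lemma measure_m: "B \<in> sets borel \<Longrightarrow> measure (m x) B = measure D {j\<in>space D. S x j \<in> B}"
  by (simp add: measure_def emeasure_m)

text \<open>The part of \<open>m x\<close> carried by sequences with first digit \<open>i\<close>.
  It is not normalised, so its quotient by \<open>m x\<close> on a ball is the conditional mass of
  the cylinder.\<close>

definition branch_meas :: "real \<Rightarrow> nat \<Rightarrow> real measure" where
  "branch_meas x i = distr (density D (indicator {j\<in>space D. j 0 = i})) borel (S x)"

lemma sets_branch [simp]: "sets (branch_meas x i) = sets borel"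
  by (simp add: branch_meas_def)

lemma emeasure_branch:
  assumes [measurable]: "B \<in> sets borel"
  shows "emeasure (branch_meas x i) B = emeasure D {j\<in>space D. j 0 = i \<and> S x j \<in> B}"
proof -
  have "emeasure (branch_meas x i) B = emeasure (density D (indicator {j\<in>space D. j 0 = i})) (S x -` B \<inter> space D)"
    unfolding branch_meas_def by (subst emeasure_distr) auto
  also have "\<dots> = emeasure D ({j\<in>space D. j 0 = i} \<inter> (S x -` B \<inter> space D))"
    by (intro emeasure_restricted) measurable
  also have "{j\<in>space D. j 0 = i} \<inter> (S x -` B \<inter> space D) = {j\<in>space D. j 0 = i \<and> S x j \<in> B}" by auto
  finally show ?thesis .
qed

lemma measure_branch:
  "B \<in> sets borel \<Longrightarrow> measure (branch_meas x i) B = measure D {j\<in>space D. j 0 = i \<and> S x j \<in> B}"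
  by (simp add: measure_def emeasure_branch)

lemma finite_measure_branch: "finite_measure (branch_meas x i)"
proof
  have "space (branch_meas x i) = UNIV" by (simp add: branch_meas_def)
  then show "emeasure (branch_meas x i) (space (branch_meas x i)) \<noteq> \<infinity>"
    by (simp add: emeasure_branch)
qed

lemma branch_le_m: 
  assumes "B \<in> sets borel" shows "measure (branch_meas x i) B \<le> measure (m x) B"
  unfolding measure_branch[OF assms] measure_m[OF assms]
  using assms by (intro D.finite_measure_mono) (auto, measurable)

definition p :: "nat \<Rightarrow> real \<times> (nat \<Rightarrow> nat) \<Rightarrow> real" where
  "p n \<omega> = measure (m (fst \<omega>)) (ball (S (fst \<omega>) (snd \<omega>)) (R * \<gamma> ^ n))"

definition q :: "nat \<Rightarrow> real \<times> (nat \<Rightarrow> nat) \<Rightarrow> real" where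
  "q n \<omega> = measure (branch_meas (fst \<omega>) (snd \<omega> 0)) (ball (S (fst \<omega>) (snd \<omega>)) (R * \<gamma> ^ n))"

text \<open>An information function: minus the logarithm of the conditional mass of the cylinder of
  the first digit in the ball of radius \<open>R * \<gamma> ^ n\<close>. Orbit sums only use
  positive indices; the value at 0 is a filler that keeps \<open>f\<close> nonnegative.\<close>

definition f :: "nat \<Rightarrow> real \<times> (nat \<Rightarrow> nat) \<Rightarrow> real" where
  "f n \<omega> = (if n = 0 then 0 else ln (p n \<omega> / q n \<omega>))"

lemma p_0: "p 0 \<omega> = 1"
proof -
  interpret prob_space "m (fst \<omega>)" by (rule prob_space_m)
  have "AE y in m (fst \<omega>). y \<in> ball (S (fst \<omega>) (snd \<omega>)) R"
    unfolding m_meas_def using S_dist_less by (subst AE_distr_iff) auto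
  then show ?thesis by (simp add: p_def prob_eq_1)
qed

lemma q_Suc:
  assumes "\<omega> \<in> space P" shows "q (Suc n) \<omega> = p n (F \<omega>) / real b"
proof -
  obtain x j where \<omega>: "\<omega> = (x, j)" by force
  have j: "j \<in> space D" using assms by (simp add: \<omega> space_P)
  let ?x = "(x + real (j 0)) / real b"
  let ?B = "{k\<in>space D. S ?x k \<in> ball (S ?x (shift j)) (R * \<gamma> ^ n)}"
  have sh: "shift k \<in> space D" if "k \<in> space D" for k using that by (simp add: space_D shift_def)
  have "{k\<in>space D. k 0 = j 0 \<and> S x k \<in> ball (S x j) (R * \<gamma> ^ Suc n)} = {k\<in>space D. k 0 = j 0 \<and> shift k \<in> ?B}"
  proof -
    have "S x k \<in> ball (S x j) (R * \<gamma> ^ Suc n) \<longleftrightarrow> S ?x (shift k) \<in> ball (S ?x (shift j)) (R * \<gamma> ^ n)" if "k 0 = j 0" for k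
    proof -
      \<comment> \<open>Equal first digits give equal \<open>\<phi>\<close>-terms in the recursion,
        which cancel; what remains is scaled by exactly \<open>\<gamma>\<close>.\<close>
      have "dist (S x j) (S x k) = \<gamma> * dist (S ?x (shift j)) (S ?x (shift k))"
        using S_rec[of x j] S_rec[of x k] that \<gamma> by (simp add: dist_real_def right_diff_distrib[symmetric] abs_mult)
      then show ?thesis using \<gamma> by (simp add: mult.left_commute)
    qed
    then show ?thesis using sh by auto
  qed
  then have "q (Suc n) \<omega> = measure D {k\<in>space D. k 0 = j 0 \<and> shift k \<in> ?B}"
    by (simp add: q_def \<omega> measure_branch del: mem_ball)
  also have "\<dots> = measure D ?B / real b"
  proof -
    have "j 0 < b" using j by (simp add: space_D)
    moreover have "S ?x -` ball (S ?x (shift j)) (R * \<gamma> ^ n) \<inter> space D \<in> sets D"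
      by (rule measurable_sets[OF Sx_measurable]) simp
    then have "?B \<in> sets D" by (simp add: vimage_def Int_def conj_commute)
    ultimately have "emeasure D {k\<in>space D. k 0 = j 0 \<and> shift k \<in> ?B} = emeasure D ?B / ennreal (real b)"
      by (rule emeasure_digit_cylinder)
    then show ?thesis using b_ge_2 by (simp add: measure_def divide_ennreal_def enn2real_mult inverse_ennreal divide_inverse)
  qed
  also have "measure D ?B = p n (F \<omega>)"
    by (simp add: p_def \<omega> F_def measure_m del: mem_ball)
  finally show ?thesis .
qed

lemma F_space: "\<omega> \<in> space P \<Longrightarrow> F \<omega> \<in> space P"
  using measurable_space[OF F_measurable] .

lemma q_le_p: "q n \<omega> \<le> p n \<omega>"
  unfolding p_def q_def by (rule branch_le_m) simp

lemma p_pos: "\<omega> \<in> space P \<Longrightarrow> 0 < p n \<omega>"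
proof (induction n arbitrary: \<omega>)
  case (Suc n)
  have "0 < q (Suc n) \<omega>" using Suc F_space b_ge_2 by (simp add: q_Suc)
  then show ?case using q_le_p[of "Suc n" \<omega>] by linarith
qed (simp add: p_0)

lemma q_pos: "\<omega> \<in> space P \<Longrightarrow> 0 < n \<Longrightarrow> 0 < q n \<omega>"
  using p_pos F_space b_ge_2 by (cases n) (auto simp: q_Suc)

lemma f_nonneg: "\<omega> \<in> space P \<Longrightarrow> 0 \<le> f n \<omega>"
  using q_pos[of \<omega> n] q_le_p[of n \<omega>] by (auto simp: f_def)

text \<open>Iterates \<open>p (Suc n) \<omega> = exp (f (Suc n) \<omega>) * p n (F \<omega>) /
  b\<close> down to \<open>p 0 = 1\<close>. Each step advances the point and gives up one scale,
  hence the index \<open>n - k\<close>.\<close>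

lemma ln_p_eq:
  "\<omega> \<in> space P \<Longrightarrow> - ln (p n \<omega>) = n * ln b - (\<Sum>k<n. f (n - k) ((F ^^ k) \<omega>))"
proof (induction n arbitrary: \<omega>)
  case (Suc n)
  have pq: "0 < p (Suc n) \<omega>" "0 < q (Suc n) \<omega>" "0 < p n (F \<omega>)"
    using Suc.prems p_pos q_pos F_space by auto
  have "f (Suc n) \<omega> = ln (p (Suc n) \<omega>) - ln (q (Suc n) \<omega>)" using pq by (simp add: f_def ln_div)
  moreover have "ln (q (Suc n) \<omega>) = ln (p n (F \<omega>)) - ln b"
    unfolding q_Suc[OF Suc.prems] using pq(3) b_ge_2 by (simp add: ln_div)
  ultimately have "- ln (p (Suc n) \<omega>) = - ln (p n (F \<omega>)) + ln b - f (Suc n) \<omega>" by simp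
  also have "- ln (p n (F \<omega>)) = n * ln b - (\<Sum>k<n. f (n - k) ((F ^^ k) (F \<omega>)))"
    using Suc.IH[OF F_space[OF Suc.prems]] .
  finally show ?case
    by (subst sum.lessThan_Suc_shift) (simp add: funpow_swap1 algebra_simps)
qed (simp add: p_0)

text \<open>Both the measure and the centre of the ball vary with \<open>\<omega>\<close>. A second,
  independent digit sequence turns the mass into the \<open>D\<close>-measure of a section of one
  measurable set in \<open>P \<Otimes>\<^sub>M D\<close>.\<close>

lemma p_measurable [measurable]: "p n \<in> borel_measurable P"
proof -
  have "(\<lambda>z. dist (S (fst (fst z)) (snd (fst z))) (S (fst (fst z)) (snd z))) \<in> borel_measurable (P \<Otimes>\<^sub>M D)"
    using measurable_compose[OF measurable_fst S_P_measurable]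
      S_measurable[OF measurable_compose[OF measurable_fst fst_P_measurable] measurable_snd]
    by (intro borel_measurable_dist) auto
  then have "{z \<in> space (P \<Otimes>\<^sub>M D). dist (S (fst (fst z)) (snd (fst z))) (S (fst (fst z)) (snd z)) < R * \<gamma> ^ n} \<in> sets (P \<Otimes>\<^sub>M D)"
    by measurable
  from D.measurable_emeasure_Pair[OF this]
  have "(\<lambda>\<omega>. measure D (Pair \<omega> -` {z \<in> space (P \<Otimes>\<^sub>M D). dist (S (fst (fst z)) (snd (fst z))) (S (fst (fst z)) (snd z)) < R * \<gamma> ^ n})) \<in> borel_measurable P"
    unfolding measure_def by measurable
  then show ?thesis
    by (rule measurable_cong[THEN iffD1, rotated])
       (auto simp: p_def measure_m space_pair_measure intro!: arg_cong[where f="measure D"])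
qed

lemma q_measurable [measurable]: "q n \<in> borel_measurable P"
proof -
  have 1: "(\<lambda>z. dist (S (fst (fst z)) (snd (fst z))) (S (fst (fst z)) (snd z))) \<in> borel_measurable (P \<Otimes>\<^sub>M D)"
    using measurable_compose[OF measurable_fst S_P_measurable]
      S_measurable[OF measurable_compose[OF measurable_fst fst_P_measurable] measurable_snd]
    by (intro borel_measurable_dist) auto
  have 2: "(\<lambda>z. real (snd (fst z) 0)) \<in> borel_measurable (P \<Otimes>\<^sub>M D)"
    using measurable_compose[OF measurable_compose[OF measurable_fst measurable_snd] digit_real_measurable] .
  have 3: "(\<lambda>z. real (snd z 0)) \<in> borel_measurable (P \<Otimes>\<^sub>M D)"
    using measurable_compose[OF measurable_snd digit_real_measurable] .
  have "{z \<in> space (P \<Otimes>\<^sub>M D). real (snd z 0) = real (snd (fst z) 0) \<and> dist (S (fst (fst z)) (snd (fst z))) (S (fst (fst z)) (snd z)) < R * \<gamma> ^ n} \<in> sets (P \<Otimes>\<^sub>M D)"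
    using 1 2 3 by measurable
  from D.measurable_emeasure_Pair[OF this]
  have "(\<lambda>\<omega>. measure D (Pair \<omega> -` {z \<in> space (P \<Otimes>\<^sub>M D). real (snd z 0) = real (snd (fst z) 0) \<and> dist (S (fst (fst z)) (snd (fst z))) (S (fst (fst z)) (snd z)) < R * \<gamma> ^ n})) \<in> borel_measurable P"
    unfolding measure_def by measurable
  then show ?thesis
    by (rule measurable_cong[THEN iffD1, rotated])
       (auto simp: q_def measure_branch space_pair_measure intro!: arg_cong[where f="measure D"])
qed

lemma f_measurable [measurable]: "f n \<in> borel_measurable P"
proof (cases "n = 0")
  case False
  have "(\<lambda>\<omega>. ln (p n \<omega> / q n \<omega>)) \<in> borel_measurable P"
    by (intro borel_measurable_ln borel_measurable_divide p_measurable q_measurable)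
  with False show ?thesis by (simp add: f_def[abs_def])
qed (simp add: f_def[abs_def])

text \<open>If \<open>f n (x, j)\<close> exceeds \<open>t\<close>, then some ball around
  \<open>S x j\<close> has \<open>m x\<close>-mass at least \<open>exp t\<close> times its mass
  under the branch of \<open>j 0\<close>. By the maximal inequality such points have mass at most
  \<open>2 * exp (- t)\<close> for that branch, the very measure governing \<open>S x j\<close> when
  the first digit is prescribed. Summing over the digits gives the factor \<open>b\<close>.\<close>

lemma f_tail_fibre:
  assumes "0 \<le> t"
  shows "emeasure D {j\<in>space D. \<exists>n. t < f n (x, j)} \<le> ennreal (2 * real b * exp (- t))"
proof -
  define \<F> where "\<F> i = {(y - s, y + s) | y s. exp t * measure (branch_meas x i) (ball y s) \<le> measure (m x) (ball y s)}" for i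
  define V where "V i = (\<Union>p\<in>\<F> i. {fst p<..<snd p})" for i
  have V: "V i \<in> sets borel" for i unfolding V_def by (intro borel_open) auto
  interpret m: prob_space "m x" by (rule prob_space_m)
  have space_m: "space (m x) = UNIV" by (simp add: m_meas_def)
  have bound: "measure (branch_meas x i) (V i) \<le> 2 * exp (- t)" for i
  proof -
    have "exp t * measure (branch_meas x i) (V i) \<le> 2 * measure (m x) UNIV"
      unfolding V_def
    proof (rule interval_maximal_inequality)
      fix p assume "p \<in> \<F> i"
      then show "exp t * measure (branch_meas x i) {fst p<..<snd p} \<le> measure (m x) {fst p<..<snd p}"
        by (auto simp: \<F>_def ball_real_interval)
    qed (simp_all add: finite_measure_branch m.finite_measure_axioms)
    also have "measure (m x) UNIV = 1" using m.prob_space space_m by simp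
    finally show ?thesis by (simp add: exp_minus field_simps)
  qed
  have sets: "{j\<in>space D. j 0 = i \<and> S x j \<in> V i} \<in> sets D" for i
  proof -
    have "S x -` V i \<inter> space D \<in> sets D" by (rule measurable_sets[OF Sx_measurable V])
    then have "{j\<in>space D. j 0 = i} \<inter> (S x -` V i \<inter> space D) \<in> sets D" by measurable
    also have "{j\<in>space D. j 0 = i} \<inter> (S x -` V i \<inter> space D) = {j\<in>space D. j 0 = i \<and> S x j \<in> V i}" by auto
    finally show ?thesis .
  qed
  have "{j\<in>space D. \<exists>n. t < f n (x, j)} \<subseteq> (\<Union>i<b. {j\<in>space D. j 0 = i \<and> S x j \<in> V i})"
  proof
    fix j assume j: "j \<in> {j\<in>space D. \<exists>n. t < f n (x, j)}"
    then obtain n where n: "t < f n (x, j)" and jD: "j \<in> space D" by blast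
    have \<omega>: "(x, j) \<in> space P" using jD by (simp add: space_P)
    have n0: "n > 0" using n \<open>0 \<le> t\<close> by (auto simp: f_def intro: ccontr)
    have pq: "0 < p n (x, j)" "0 < q n (x, j)" using p_pos[OF \<omega>] q_pos[OF \<omega> n0] by auto
    have "exp t \<le> p n (x, j) / q n (x, j)"
      using n n0 pq by (subst ln_ge_iff[symmetric]) (auto simp: f_def)
    then have "exp t * q n (x, j) \<le> p n (x, j)" using pq by (simp add: field_simps)
    then have "(S x j - R * \<gamma> ^ n, S x j + R * \<gamma> ^ n) \<in> \<F> (j 0)"
      unfolding \<F>_def p_def q_def by auto
    then have "S x j \<in> V (j 0)" unfolding V_def using R_pos \<gamma> by (intro UN_I) auto
    then show "j \<in> (\<Union>i<b. {j\<in>space D. j 0 = i \<and> S x j \<in> V i})"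
      using jD by (auto simp: space_D)
  qed
  then have "emeasure D {j\<in>space D. \<exists>n. t < f n (x, j)} \<le> emeasure D (\<Union>i<b. {j\<in>space D. j 0 = i \<and> S x j \<in> V i})"
    using sets by (intro emeasure_mono) auto
  also have "\<dots> \<le> (\<Sum>i<b. emeasure D {j\<in>space D. j 0 = i \<and> S x j \<in> V i})"
    using sets by (intro emeasure_subadditive_finite) auto
  also have "\<dots> \<le> (\<Sum>i<b. ennreal (2 * exp (- t)))"
  proof (intro sum_mono)
    fix i
    interpret B: finite_measure "branch_meas x i" by (rule finite_measure_branch)
    have "emeasure D {j\<in>space D. j 0 = i \<and> S x j \<in> V i} = ennreal (measure (branch_meas x i) (V i))"
      by (subst emeasure_branch[OF V, symmetric]) (rule B.emeasure_eq_measure)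
    also have "\<dots> \<le> ennreal (2 * exp (- t))" by (intro ennreal_leI bound)
    finally show "emeasure D {j\<in>space D. j 0 = i \<and> S x j \<in> V i} \<le> ennreal (2 * exp (- t))" .
  qed
  also have "\<dots> = ennreal (2 * real b * exp (- t))"
    by (simp add: ennreal_of_nat_eq_real_of_nat ennreal_mult''[symmetric] mult_ac)
  finally show ?thesis .
qed

lemma f_tail:
  assumes "0 \<le> t"
  shows "emeasure P {\<omega>\<in>space P. \<exists>n. t < f n \<omega>} \<le> ennreal (2 * real b * exp (- t))"
proof -
  let ?X = "{\<omega>\<in>space P. \<exists>n. t < f n \<omega>}"
  have X: "?X \<in> sets P" by measurable
  have "emeasure P ?X = (\<integral>\<^sup>+x. emeasure D (Pair x -` ?X) \<partial>\<U>)"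
    by (rule D.emeasure_pair_measure_alt[OF X])
  also have "\<dots> \<le> (\<integral>\<^sup>+x. ennreal (2 * real b * exp (- t)) \<partial>\<U>)"
  proof (intro nn_integral_mono)
    fix x
    have "Pair x -` ?X = {j\<in>space D. \<exists>n. t < f n (x, j)}" by (auto simp: space_P)
    then show "emeasure D (Pair x -` ?X) \<le> ennreal (2 * real b * exp (- t))"
      using f_tail_fibre[OF assms, of x] by simp
  qed
  also have "\<dots> = ennreal (2 * real b * exp (- t))" using U.emeasure_space_1 by simp
  finally show ?thesis .
qed

text \<open>The tail bound treats all scales at once, so the supremum over \<open>n\<close> has
  exponential tails and is integrable.\<close>

lemma f_dominated:
  obtains G where "integrable P G" "AE \<omega> in P. \<forall>n. \<bar>f n \<omega>\<bar> \<le> G \<omega>"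
proof -
  \<comment> \<open>Taken in \<open>ennreal\<close>, where the supremum always exists; finiteness
    almost everywhere follows only from the bound on its integral.\<close>
  define g where "g \<omega> = (SUP n. ennreal (f n \<omega>))" for \<omega>
  have g [measurable]: "g \<in> borel_measurable P" unfolding g_def by measurable
  have "(\<integral>\<^sup>+\<omega>. g \<omega> \<partial>P) \<le> (\<integral>\<^sup>+\<omega>. (\<Sum>k::nat. if of_nat k < g \<omega> then 1 else 0) \<partial>P)"
    by (intro nn_integral_mono ennreal_le_count_less)
  also have "\<dots> = (\<Sum>k::nat. (\<integral>\<^sup>+\<omega>. (if of_nat k < g \<omega> then 1 else 0) \<partial>P))"
    by (intro nn_integral_suminf) measurable
  also have "\<dots> \<le> (\<Sum>k::nat. ennreal (2 * real b * exp (- real k)))"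
  proof (intro suminf_le)
    fix k :: nat
    have "(\<integral>\<^sup>+\<omega>. (if of_nat k < g \<omega> then 1 else 0) \<partial>P) = (\<integral>\<^sup>+\<omega>. indicator {\<omega>\<in>space P. \<exists>n. real k < f n \<omega>} \<omega> \<partial>P)"
    proof (intro nn_integral_cong)
      fix \<omega> assume \<omega>: "\<omega> \<in> space P"
      have "of_nat k < g \<omega> \<longleftrightarrow> (\<exists>n. real k < f n \<omega>)"
        unfolding g_def less_SUP_iff using f_nonneg[OF \<omega>]
        by (simp add: ennreal_of_nat_eq_real_of_nat ennreal_less_iff)
      then show "(if of_nat k < g \<omega> then 1 else 0) = (indicator {\<omega>\<in>space P. \<exists>n. real k < f n \<omega>} \<omega> :: ennreal)"
        using \<omega> by simp
    qed
    also have "\<dots> = emeasure P {\<omega>\<in>space P. \<exists>n. real k < f n \<omega>}" by (intro nn_integral_indicator) measurable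
    also have "\<dots> \<le> ennreal (2 * real b * exp (- real k))" by (rule f_tail) simp
    finally show "(\<integral>\<^sup>+\<omega>. (if of_nat k < g \<omega> then 1 else 0) \<partial>P) \<le> ennreal (2 * real b * exp (- real k))" .
  qed auto
  also have "\<dots> < \<top>"
  proof -
    have "summable (\<lambda>k. 2 * real b * exp (-1) ^ k)" by (intro summable_mult summable_geometric) simp
    then have "summable (\<lambda>k. 2 * real b * exp (- real k))" by (simp add: exp_of_nat_mult[symmetric])
    then have "(\<Sum>k. ennreal (2 * real b * exp (- real k))) = ennreal (\<Sum>k. 2 * real b * exp (- real k))"
      by (intro suminf_ennreal2) auto
    then show ?thesis by simp
  qed
  finally have fin: "(\<integral>\<^sup>+\<omega>. g \<omega> \<partial>P) < \<top>" .
  then have AEg: "AE \<omega> in P. g \<omega> \<noteq> \<infinity>" by (intro nn_integral_PInf_AE) auto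
  show thesis
  proof (rule that)
    have "(\<integral>\<^sup>+\<omega>. ennreal (enn2real (g \<omega>)) \<partial>P) = (\<integral>\<^sup>+\<omega>. g \<omega> \<partial>P)"
      using AEg by (intro nn_integral_cong_AE) (auto simp: less_top elim!: eventually_mono)
    then show "integrable P (\<lambda>\<omega>. enn2real (g \<omega>))"
      using fin by (intro integrableI_nonneg) auto
    show "AE \<omega> in P. \<forall>n. \<bar>f n \<omega>\<bar> \<le> enn2real (g \<omega>)"
      using AEg AE_space
    proof eventually_elim
      case (elim \<omega>)
      show ?case
      proof
        fix n
        have "ennreal (f n \<omega>) \<le> g \<omega>" unfolding g_def by (rule SUP_upper) simp
        also have "\<dots> = ennreal (enn2real (g \<omega>))" using elim by (simp add: less_top)
        finally show "\<bar>f n \<omega>\<bar> \<le> enn2real (g \<omega>)" using f_nonneg[OF elim(2), of n] by simp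
      qed
    qed
  qed
qed

lemma absolutely_continuous_branch: "absolutely_continuous (m x) (branch_meas x i)"
  unfolding absolutely_continuous_def
proof
  fix A assume A: "A \<in> null_sets (m x)"
  then have As: "A \<in> sets borel" by (auto simp: null_sets_def)
  interpret m: prob_space "m x" by (rule prob_space_m)
  interpret B: finite_measure "branch_meas x i" by (rule finite_measure_branch)
  have "measure (m x) A = 0" using A by (simp add: measure_eq_0_null_sets)
  with branch_le_m[OF As, of x i] have "measure (branch_meas x i) A = 0" by (simp add: measure_le_0_iff)
  then show "A \<in> null_sets (branch_meas x i)" using As by (simp add: null_sets_def B.emeasure_eq_measure)
qed

section \<open>Limit of the information and local dimension of the fibres\<close>

lemma radii: "(\<lambda>n. R * \<gamma> ^ n) \<longlonglongrightarrow> 0" "0 < R * \<gamma> ^ n"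
  using R_pos \<gamma> by (auto intro!: tendsto_eq_intros LIMSEQ_realpow_zero)

lemma ratio_convergent: "AE \<omega> in P. convergent (\<lambda>n. q n \<omega> / p n \<omega>)"
proof (rule UD.AE_pair_measure)
  have "(\<lambda>\<omega>. q n \<omega> / p n \<omega>) \<in> borel_measurable P" for n by measurable
  then show "{\<omega>\<in>space P. convergent (\<lambda>n. q n \<omega> / p n \<omega>)} \<in> sets P"
    unfolding Cauchy_convergent_iff[symmetric] by (rule sets_Collect_Cauchy)
  show "AE x in \<U>. AE j in D. convergent (\<lambda>n. q n (x, j) / p n (x, j))"
  proof (rule AE_I2)
    fix x
    interpret m: prob_space "m x" by (rule prob_space_m)
    \<comment> \<open>The point \<open>S x j\<close> need not determine \<open>j 0\<close>, so
      convergence is secured for all digits \<open>i\<close> simultaneously.\<close>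
    have "AE y in m x. \<forall>i. (\<forall>n. 0 < measure (m x) (ball y (R * \<gamma> ^ n))) \<longrightarrow>
        convergent (\<lambda>n. measure (branch_meas x i) (ball y (R * \<gamma> ^ n)) / measure (m x) (ball y (R * \<gamma> ^ n)))"
      unfolding AE_all_countable
      by (intro allI ball_ratio_convergent m.finite_measure_axioms finite_measure_branch absolutely_continuous_branch radii) simp_all
    then have "AE y in distr D borel (S x). \<forall>i. (\<forall>n. 0 < measure (m x) (ball y (R * \<gamma> ^ n))) \<longrightarrow>
        convergent (\<lambda>n. measure (branch_meas x i) (ball y (R * \<gamma> ^ n)) / measure (m x) (ball y (R * \<gamma> ^ n)))"
      by (subst (asm) m_meas_def)
    from AE_distrD[OF Sx_measurable this] show "AE j in D. convergent (\<lambda>n. q n (x, j) / p n (x, j))"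
      using AE_space
    proof eventually_elim
      case (elim j)
      have "0 < measure (m x) (ball (S x j) (R * \<gamma> ^ n))" for n
        using p_pos[of "(x, j)" n] elim(2) by (simp add: p_def space_P)
      with elim(1) show ?case by (simp add: p_def q_def)
    qed
  qed
qed

text \<open>Logarithms of convergent ratios converge only if the limit is positive. The dominating
  function ensures this by keeping the ratios above \<open>exp (- G \<omega>)\<close>.\<close>

lemma f_convergent: "AE \<omega> in P. convergent (\<lambda>n. f n \<omega>)"
proof -
  obtain G where "integrable P G" and G: "AE \<omega> in P. \<forall>n. \<bar>f n \<omega>\<bar> \<le> G \<omega>" by (rule f_dominated)
  show ?thesis using G ratio_convergent AE_space
  proof eventually_elim
    case (elim \<omega>)
    obtain l where l: "(\<lambda>n. q n \<omega> / p n \<omega>) \<longlonglongrightarrow> l" using elim(2) by (auto simp: convergent_def)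
    have *: "exp (- f n \<omega>) = q n \<omega> / p n \<omega>" if "n > 0" for n
      using p_pos[OF elim(3), of n] q_pos[OF elim(3) that] that
      by (simp add: f_def exp_minus)
    have "exp (- G \<omega>) \<le> q n \<omega> / p n \<omega>" if "n \<ge> 1" for n
    proof -
      have "f n \<omega> \<le> G \<omega>" using elim(1) abs_le_D1 by blast
      then show ?thesis using * that by (simp flip: *)
    qed
    then have "exp (- G \<omega>) \<le> l" by (intro LIMSEQ_le_const[OF l]) blast
    then have "0 < l" using exp_gt_zero[of "- G \<omega>"] by linarith
    then have "(\<lambda>n. - ln (q n \<omega> / p n \<omega>)) \<longlonglongrightarrow> - ln l" by (intro tendsto_intros l) simp
    moreover have "eventually (\<lambda>n. - ln (q n \<omega> / p n \<omega>) = f n \<omega>) sequentially"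
      using eventually_gt_at_top[of 0] by eventually_elim (simp flip: *)
    ultimately have "(\<lambda>n. f n \<omega>) \<longlonglongrightarrow> - ln l" by (rule Lim_transform_eventually)
    then show ?case by (rule convergentI)
  qed
qed

lemma local_dimension:
  obtains \<alpha> where "AE \<omega> in P. (\<forall>r>0. 0 < measure (m (fst \<omega>)) (ball (S (fst \<omega>) (snd \<omega>)) r)) \<and>
      ((\<lambda>r. ln (measure (m (fst \<omega>)) (ball (S (fst \<omega>) (snd \<omega>)) r)) / ln r) \<longlongrightarrow> \<alpha>) (at_right 0)"
proof -
  obtain G where G: "integrable P G" "AE \<omega> in P. \<forall>n. \<bar>f n \<omega>\<bar> \<le> G \<omega>" by (rule f_dominated)
  define fl where "fl \<omega> = lim (\<lambda>n. f n \<omega>)" for \<omega>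
  have "fl \<in> borel_measurable P" unfolding fl_def by measurable
  moreover have "AE \<omega> in P. (\<lambda>n. f n \<omega>) \<longlonglongrightarrow> fl \<omega>"
    using f_convergent unfolding fl_def by eventually_elim (simp add: convergent_LIMSEQ_iff)
  ultimately have *: "AE \<omega> in P. (\<lambda>n. (\<Sum>k<n. f (n - k) ((F ^^ k) \<omega>)) / n) \<longlonglongrightarrow> (\<integral>\<omega>. fl \<omega> \<partial>P)"
    using G by (intro erg.maker_ergodic) auto
  \<comment> \<open>The exponential decay rate of \<open>p n\<close>. The radii decay at rate
    \<open>- ln \<gamma>\<close>, and the dimension is the quotient of the two rates.\<close>
  define h where "h = ln b - (\<integral>\<omega>. fl \<omega> \<partial>P)"
  show thesis
  proof (rule that)
    show "AE \<omega> in P. (\<forall>r>0. 0 < measure (m (fst \<omega>)) (ball (S (fst \<omega>) (snd \<omega>)) r)) \<and>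
      ((\<lambda>r. ln (measure (m (fst \<omega>)) (ball (S (fst \<omega>) (snd \<omega>)) r)) / ln r) \<longlongrightarrow> h / (- ln \<gamma>)) (at_right 0)"
      using * AE_space
    proof eventually_elim
      case (elim \<omega>)
      interpret m: prob_space "m (fst \<omega>)" by (rule prob_space_m)
      let ?a = "\<lambda>r. measure (m (fst \<omega>)) (ball (S (fst \<omega>) (snd \<omega>)) r)"
      have "(\<lambda>n. ln b - (\<Sum>k<n. f (n - k) ((F ^^ k) \<omega>)) / n) \<longlonglongrightarrow> h"
        unfolding h_def by (intro tendsto_intros elim)
      moreover have "eventually (\<lambda>n. ln b - (\<Sum>k<n. f (n - k) ((F ^^ k) \<omega>)) / n = - ln (p n \<omega>) / n) sequentially"
        using eventually_gt_at_top[of 0]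
        by eventually_elim (simp add: ln_p_eq[OF elim(2)] diff_divide_distrib)
      ultimately have "(\<lambda>n. - ln (p n \<omega>) / n) \<longlonglongrightarrow> h" by (rule Lim_transform_eventually)
      then have lim: "(\<lambda>n. - ln (?a (R * \<gamma> ^ n)) / n) \<longlonglongrightarrow> h" by (simp add: p_def)
      have mono: "?a r \<le> ?a s" if "0 < r" "r \<le> s" for r s
        using that by (intro m.finite_measure_mono) auto
      have pos: "0 < ?a (R * \<gamma> ^ n)" for n using p_pos[OF elim(2), of n] by (simp add: p_def)
      show ?case
        using local_dimension_along_sequence[of ?a, OF mono pos R_pos \<gamma> lim] by blast
    qed
  qed
qed

section \<open>The measure on the plane\<close>

definition W :: "(real \<times> real) measure" where
  "W = distr P borel (\<lambda>\<omega>. (fst \<omega>, S (fst \<omega>) (snd \<omega>)))"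

lemma graph_measurable: "(\<lambda>\<omega>. (fst \<omega>, S (fst \<omega>) (snd \<omega>))) \<in> borel_measurable P"
  by (intro borel_measurable_Pair fst_P_measurable S_P_measurable)

lemma emeasure_W:
  assumes A: "A \<in> sets borel"
  shows "emeasure W A = (\<integral>\<^sup>+x. emeasure D {j\<in>space D. (x, S x j) \<in> A} \<partial>\<U>)"
    and "(\<lambda>x. emeasure D {j\<in>space D. (x, S x j) \<in> A}) \<in> borel_measurable borel"
proof -
  let ?X = "(\<lambda>\<omega>. (fst \<omega>, S (fst \<omega>) (snd \<omega>))) -` A \<inter> space P"
  have X: "?X \<in> sets P" by (rule measurable_sets[OF graph_measurable A])
  have eq: "Pair x -` ?X = {j\<in>space D. (x, S x j) \<in> A}" for x by (auto simp: space_P)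
  have "emeasure W A = emeasure P ?X" unfolding W_def by (rule emeasure_distr[OF graph_measurable A])
  also have "\<dots> = (\<integral>\<^sup>+x. emeasure D (Pair x -` ?X) \<partial>\<U>)" by (rule D.emeasure_pair_measure_alt[OF X])
  finally show "emeasure W A = (\<integral>\<^sup>+x. emeasure D {j\<in>space D. (x, S x j) \<in> A} \<partial>\<U>)" unfolding eq .
  have "(\<lambda>x. emeasure D (Pair x -` ?X)) \<in> borel_measurable \<U>" by (rule D.measurable_emeasure_Pair[OF X])
  then show "(\<lambda>x. emeasure D {j\<in>space D. (x, S x j) \<in> A}) \<in> borel_measurable borel"
    unfolding eq by (simp add: measurable_cong_sets[OF sets_uniform_measure refl] measurable_lborel1)
qed

lemma sets_W [simp]: "sets W = sets borel" and space_W [simp]: "space W = UNIV"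
  by (simp_all add: W_def)

text \<open>Countable additivity of the defining integral comes for free, since
  \<open>measure_of_eq\<close> only asks for agreement with the measure \<open>W\<close> on Borel
  sets. As an image of \<open>P\<close>, \<open>W\<close> inherits the almost-sure statements about
  pairs of a point and a digit sequence.\<close>

lemma omega_eq_W: "omega_meas b \<gamma> \<phi> = W"
proof -
  have "omega_meas b \<gamma> \<phi> = measure_of UNIV (sets borel) (emeasure W)"
    unfolding omega_meas_def
  proof (rule measure_of_eq)
    fix A :: "(real \<times> real) set" assume "A \<in> sigma_sets UNIV (sets borel)"
    then have A: "A \<in> sets borel" using sets.sigma_sets_eq[of "borel :: (real \<times> real) measure"] by simp
    have Ax: "Pair x -` A \<in> sets borel" for x :: real
    proof -
      have "A \<in> sets (borel \<Otimes>\<^sub>M borel)" by (subst borel_prod) (rule A)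
      then show ?thesis by (rule sets_Pair1)
    qed
    have "emeasure W A = (\<integral>\<^sup>+x. emeasure D {j\<in>space D. (x, S x j) \<in> A} \<partial>\<U>)" by (rule emeasure_W(1)[OF A])
    also have "\<dots> = (\<integral>\<^sup>+x. emeasure D {j\<in>space D. (x, S x j) \<in> A} * indicator {0..<1} x \<partial>lborel) / emeasure lborel {0..<1::real}"
      using emeasure_W(2)[OF A] by (intro nn_integral_uniform_measure) auto
    also have "\<dots> = (\<integral>\<^sup>+x. indicator {0..<1} x * emeasure (m x) (Pair x -` A) \<partial>lborel)"
      by (simp add: divide_ennreal_def emeasure_m[OF Ax] mult.commute)
    finally show "(\<integral>\<^sup>+x. indicator {0..<1} x * emeasure (m x) (Pair x -` A) \<partial>lborel) = emeasure W A" by simp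
  qed simp
  also have "\<dots> = measure_of (space W) (sets W) (emeasure W)" by simp
  also have "\<dots> = W" by (rule measure_of_of_measure)
  finally show ?thesis .
qed

lemma prob_space_W: "prob_space W"
  unfolding W_def by (rule UD.prob_space_distr[OF graph_measurable])

text \<open>Sliding a point of the ball to the fibre over \<open>x\<close> along the same digits
  moves it vertically by at most \<open>L * r\<close>. One fibre thus controls all those that meet
  the ball, and their base points fill length at most \<open>2 * r\<close>.\<close>

lemma measure_W_ball_upper:
  assumes "0 < r"
  shows "measure W (ball (x, y) r) \<le> 2 * r * measure (m x) (ball y ((1 + L) * r))"
proof -
  interpret W: prob_space W by (rule prob_space_W)
  define c where "c = measure (m x) (ball y ((1 + L) * r))"
  have "emeasure W (ball (x, y) r) = (\<integral>\<^sup>+x'. emeasure D {j\<in>space D. (x', S x' j) \<in> ball (x, y) r} \<partial>\<U>)"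
    by (rule emeasure_W) simp
  also have "\<dots> \<le> (\<integral>\<^sup>+x'. ennreal c * indicator (ball x r) x' \<partial>\<U>)"
  proof (intro nn_integral_mono)
    fix x'
    show "emeasure D {j\<in>space D. (x', S x' j) \<in> ball (x, y) r} \<le> ennreal c * indicator (ball x r) x'"
    proof (cases "x' \<in> ball x r")
      case True
      have "{j\<in>space D. (x', S x' j) \<in> ball (x, y) r} \<subseteq> {j\<in>space D. S x j \<in> ball y ((1 + L) * r)}"
      proof safe
        fix j assume "(x', S x' j) \<in> ball (x, y) r"
        then have "dist y (S x' j) < r" using dist_snd_le[of "(x, y)" "(x', S x' j)"] by simp
        moreover have "\<bar>S x j - S x' j\<bar> \<le> L * r"
          by (rule order_trans[OF S_lipschitz mult_left_mono]) (use True L_nonneg in \<open>auto simp: dist_real_def\<close>)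
        ultimately show "S x j \<in> ball y ((1 + L) * r)" by (simp add: dist_real_def algebra_simps)
      qed
      moreover have "{j\<in>space D. S x j \<in> ball y ((1 + L) * r)} \<in> sets D"
        using measurable_sets[OF Sx_measurable, of "ball y ((1 + L) * r)" x] by (simp add: vimage_def Int_def conj_commute)
      ultimately have "emeasure D {j\<in>space D. (x', S x' j) \<in> ball (x, y) r} \<le> emeasure D {j\<in>space D. S x j \<in> ball y ((1 + L) * r)}"
        by (rule emeasure_mono)
      also have "\<dots> = ennreal c"
        unfolding c_def by (subst measure_m) (simp_all add: D.emeasure_eq_measure del: mem_ball)
      finally show ?thesis using True by simp
    next
      case False
      then have "{j\<in>space D. (x', S x' j) \<in> ball (x, y) r} = {}"
        using dist_fst_le[of "(x, y)" "(x', S x' _)"] by (auto intro: le_less_trans)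
      then show ?thesis by (simp only: emeasure_empty) simp
    qed
  qed
  also have "\<dots> = ennreal c * emeasure \<U> (ball x r)"
    by (rule nn_integral_cmult_indicator) simp
  also have "\<dots> \<le> ennreal c * ennreal (2 * r)"
  proof (rule mult_left_mono)
    have "emeasure \<U> (ball x r) \<le> emeasure lborel (ball x r)"
      by (subst emeasure_U) (auto intro!: emeasure_mono)
    also have "\<dots> = ennreal (2 * r)" using assms by (simp add: ball_eq_greaterThanLessThan)
    finally show "emeasure \<U> (ball x r) \<le> ennreal (2 * r)" .
  qed simp
  also have "\<dots> = ennreal (2 * r * c)" using assms by (subst ennreal_mult''[symmetric]) (simp_all add: mult.commute)
  finally have "emeasure W (ball (x, y) r) \<le> ennreal (2 * r * c)" .
  then show ?thesis using assms by (simp add: W.emeasure_eq_measure c_def)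
qed

lemma measure_W_ball_lower:
  assumes "0 < r" "0 \<le> x" "x + r / (4 * (1 + L)) \<le> 1"
  shows "r / (4 * (1 + L)) * measure (m x) (ball y (1 / 4 * r)) \<le> measure W (ball (x, y) r)"
proof -
  interpret W: prob_space W by (rule prob_space_W)
  define c where "c = measure (m x) (ball y (1 / 4 * r))"
  \<comment> \<open>The horizontal offset stays below \<open>d\<close> and the vertical one below
    \<open>r / 4 + L * d\<close>, together \<open>r / 2\<close>. The strip lies to the right of
    \<open>x\<close> only, so it remains in the unit interval for every \<open>x < 1\<close> once
    \<open>r\<close> is small.\<close>
  define d where "d = r / (4 * (1 + L))"
  have "M * (r / (4 * M)) = r / 4" if "M > 0" for M :: real using that by simp
  from this[of "1 + L"] have d: "0 < d" "(1 + L) * d = r / 4" using L_nonneg assms(1) by (auto simp: d_def)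
  have "ennreal c * emeasure \<U> {x..<x + d} = (\<integral>\<^sup>+x'. ennreal c * indicator {x..<x + d} x' \<partial>\<U>)"
    by (rule nn_integral_cmult_indicator[symmetric]) simp
  also have "\<dots> \<le> (\<integral>\<^sup>+x'. emeasure D {j\<in>space D. (x', S x' j) \<in> ball (x, y) r} \<partial>\<U>)"
  proof (intro nn_integral_mono)
    fix x'
    show "ennreal c * indicator {x..<x + d} x' \<le> emeasure D {j\<in>space D. (x', S x' j) \<in> ball (x, y) r}"
    proof (cases "x' \<in> {x..<x + d}")
      case True
      have "{j\<in>space D. S x j \<in> ball y (1 / 4 * r)} \<subseteq> {j\<in>space D. (x', S x' j) \<in> ball (x, y) r}"
      proof safe
        fix j assume j: "S x j \<in> ball y (1 / 4 * r)"
        have "\<bar>S x j - S x' j\<bar> \<le> L * d"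
          by (rule order_trans[OF S_lipschitz mult_left_mono]) (use True L_nonneg in auto)
        moreover have "\<bar>y - S x j\<bar> < r / 4" using j by (simp add: dist_real_def)
        ultimately have "dist y (S x' j) < r / 4 + L * d" unfolding dist_real_def by linarith
        moreover have "dist x x' < d" using True by (simp add: dist_real_def)
        moreover have "dist (x, y) (x', S x' j) \<le> dist x x' + dist y (S x' j)"
          unfolding dist_Pair_Pair by (rule sqrt_sum_squares_le_sum) simp_all
        ultimately show "(x', S x' j) \<in> ball (x, y) r" using d assms(1) by (simp add: algebra_simps)
      qed
      moreover have "{j\<in>space D. (x', S x' j) \<in> ball (x, y) r} \<in> sets D"
      proof -
        have "(\<lambda>j. (x', S x' j)) \<in> borel_measurable D" by (intro borel_measurable_Pair) simp_all
        from measurable_sets[OF this, of "ball (x, y) r"] show ?thesis by (simp add: vimage_def Int_def conj_commute)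
      qed
      ultimately have "emeasure D {j\<in>space D. S x j \<in> ball y (1 / 4 * r)} \<le> emeasure D {j\<in>space D. (x', S x' j) \<in> ball (x, y) r}"
        by (rule emeasure_mono)
      moreover have "emeasure D {j\<in>space D. S x j \<in> ball y (1 / 4 * r)} = ennreal c"
        unfolding c_def by (subst measure_m) (simp_all add: D.emeasure_eq_measure del: mem_ball)
      ultimately show ?thesis using True by simp
    qed simp
  qed
  also have "\<dots> = emeasure W (ball (x, y) r)" by (rule emeasure_W(1)[symmetric]) simp
  also have "emeasure \<U> {x..<x + d} = ennreal d"
  proof -
    have "{0..<1} \<inter> {x..<x + d} = {x..<x + d}" using assms by (auto simp: d_def)
    then show ?thesis using d(1) by (subst emeasure_U) auto
  qed
  finally have "ennreal (d * c) \<le> emeasure W (ball (x, y) r)"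
    using d(1) by (simp add: ennreal_mult'' mult.commute c_def)
  then show ?thesis by (simp add: W.emeasure_eq_measure c_def d_def)
qed

lemma local_dimension_W:
  assumes x: "0 \<le> x" "x < 1"
    and pos: "\<And>r. 0 < r \<Longrightarrow> 0 < measure (m x) (ball y r)"
    and lim: "((\<lambda>r. ln (measure (m x) (ball y r)) / ln r) \<longlongrightarrow> \<alpha>) (at_right 0)"
  shows "(\<forall>r>0. 0 < measure W (ball (x, y) r)) \<and> ((\<lambda>r. ln (measure W (ball (x, y) r)) / ln r) \<longlongrightarrow> 1 + \<alpha>) (at_right 0)"
proof -
  interpret W: prob_space W by (rule prob_space_W)
  let ?a = "\<lambda>r. measure (m x) (ball y r)" and ?w = "\<lambda>r. measure W (ball (x, y) r)"
  let ?M = "4 * (1 + L)"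
  have M: "?M > 0" using L_nonneg by simp
  have low: "r / ?M * ?a (1 / 4 * r) \<le> ?w r" if "0 < r" "r \<le> ?M * (1 - x)" for r
    using that M by (intro measure_W_ball_lower x) (auto simp: field_simps)
  have Mx: "0 < ?M * (1 - x)" using M x by simp
  have wpos: "0 < ?w r" if "0 < r" for r
  proof -
    \<comment> \<open>The lower bound covers small radii; larger balls inherit positivity by
      monotonicity.\<close>
    let ?s = "min r (?M * (1 - x))"
    have "0 < ?s / ?M * ?a (1 / 4 * ?s)" using that Mx M pos[of "1 / 4 * ?s"] by (intro mult_pos_pos divide_pos_pos) auto
    also have "\<dots> \<le> ?w ?s" using that Mx by (intro low) auto
    also have "\<dots> \<le> ?w r" by (intro W.finite_measure_mono) auto
    finally show ?thesis .
  qed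
  have small: "eventually (\<lambda>r. 0 < r \<and> r < 1 \<and> r \<le> ?M * (1 - x)) (at_right 0)"
    using eventually_at_right_real[of 0 "min 1 (?M * (1 - x))"] Mx by (auto elim!: eventually_mono)
  have "((\<lambda>r. ln (?w r) / ln r) \<longlongrightarrow> 1 + \<alpha>) (at_right 0)"
  proof (rule tendsto_sandwich)
    \<comment> \<open>The base direction contributes one factor \<open>r\<close>, the source of the
      1 in \<open>1 + \<alpha>\<close>.\<close>
    have "((\<lambda>r. (ln 2 + ln r) / ln r) \<longlongrightarrow> 1) (at_right (0::real))" by real_asymp
    then show "((\<lambda>r. (ln 2 + ln r) / ln r + ln (?a ((1 + L) * r)) / ln r) \<longlongrightarrow> 1 + \<alpha>) (at_right 0)"
      using L_nonneg by (intro tendsto_add local_dimension_rescale[OF lim]) auto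
    have "((\<lambda>r. (ln r - ln ?M) / ln r) \<longlongrightarrow> 1) (at_right (0::real))" by real_asymp
    then show "((\<lambda>r. (ln r - ln ?M) / ln r + ln (?a (1 / 4 * r)) / ln r) \<longlongrightarrow> 1 + \<alpha>) (at_right 0)"
      by (intro tendsto_add local_dimension_rescale[OF lim]) auto
    show "\<forall>\<^sub>F r in at_right 0. (ln 2 + ln r) / ln r + ln (?a ((1 + L) * r)) / ln r \<le> ln (?w r) / ln r"
      using small
    proof eventually_elim
      case (elim r)
      have a: "0 < ?a ((1 + L) * r)" using elim L_nonneg by (intro pos) simp
      have "ln (?w r) \<le> ln (2 * r * ?a ((1 + L) * r))"
        using elim wpos[of r] a measure_W_ball_upper[of r x y] by (subst ln_le_cancel_iff) auto
      also have "\<dots> = ln 2 + ln r + ln (?a ((1 + L) * r))" using elim a by (simp add: ln_mult)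
      finally show ?case using elim
        by (subst add_divide_distrib[symmetric]) (intro divide_right_mono_neg, auto)
    qed
    show "\<forall>\<^sub>F r in at_right 0. ln (?w r) / ln r \<le> (ln r - ln ?M) / ln r + ln (?a (1 / 4 * r)) / ln r"
      using small
    proof eventually_elim
      case (elim r)
      have a: "0 < ?a (1 / 4 * r)" using elim by (intro pos) simp
      have "ln r - ln ?M + ln (?a (1 / 4 * r)) = ln (r / ?M * ?a (1 / 4 * r))"
        using elim a M by (simp only: ln_mult_pos divide_pos_pos ln_divide_pos)
      also have "\<dots> \<le> ln (?w r)"
        using elim wpos[of r] a M low[of r] by (subst ln_le_cancel_iff) (auto intro!: mult_pos_pos divide_pos_pos)
      finally show ?case using elim
        by (subst add_divide_distrib[symmetric]) (intro divide_right_mono_neg, auto)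
    qed
  qed
  with wpos show ?thesis by blast
qed

theorem exact_dimensionality:
  "\<exists>\<alpha>\<in>{0..1}. (AE x in lborel. x \<in> {0..1} \<longrightarrow> exact_dimensional (m x) \<alpha>) \<and>
     exact_dimensional (omega_meas b \<gamma> \<phi>) (1 + \<alpha>)"
proof -
  obtain \<alpha> where \<alpha>: "AE \<omega> in P. (\<forall>r>0. 0 < measure (m (fst \<omega>)) (ball (S (fst \<omega>) (snd \<omega>)) r)) \<and>
      ((\<lambda>r. ln (measure (m (fst \<omega>)) (ball (S (fst \<omega>) (snd \<omega>)) r)) / ln r) \<longlongrightarrow> \<alpha>) (at_right 0)"
    by (rule local_dimension)
  have fibre: "AE x in \<U>. exact_dimensional (m x) \<alpha>"
    using UD.AE_pair[OF \<alpha>]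
  proof eventually_elim
    case (elim x)
    then show ?case unfolding m_meas_def
      by (intro exact_dimensional_distrI D.prob_space_axioms Sx_measurable) simp
  qed
  then have lborel: "AE x in lborel. x \<in> {0..<1} \<longrightarrow> exact_dimensional (m x) \<alpha>"
    by (subst (asm) AE_uniform_measure) auto
  \<comment> \<open>\<open>\<U>\<close> is carried by the half-open interval, so the endpoint is
    discarded as a null set.\<close>
  have "AE x in lborel. x \<noteq> (1::real)" by (rule AE_lborel_singleton)
  with lborel have 1: "AE x in lborel. x \<in> {0..1} \<longrightarrow> exact_dimensional (m x) \<alpha>"
    by eventually_elim auto
  have "AE \<omega> in P. 0 \<le> fst \<omega> \<and> fst \<omega> < 1"
  proof (rule UD.AE_pair_measure)
    show "{\<omega>\<in>space P. 0 \<le> fst \<omega> \<and> fst \<omega> < 1} \<in> sets P"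
      using fst_P_measurable by measurable
    show "AE x in \<U>. AE j in D. 0 \<le> fst (x, j) \<and> fst (x, j) < 1" using AE_U_unit by simp
  qed
  with \<alpha> have "AE \<omega> in P. (\<forall>r>0. 0 < measure W (ball (fst \<omega>, S (fst \<omega>) (snd \<omega>)) r)) \<and>
      ((\<lambda>r. ln (measure W (ball (fst \<omega>, S (fst \<omega>) (snd \<omega>)) r)) / ln r) \<longlongrightarrow> 1 + \<alpha>) (at_right 0)"
  proof eventually_elim
    case (elim \<omega>)
    then show ?case by (intro local_dimension_W) auto
  qed
  then have 2: "exact_dimensional W (1 + \<alpha>)"
    unfolding W_def by (intro exact_dimensional_distrI UD.prob_space_axioms graph_measurable)
  \<comment> \<open>Both bounds on \<open>\<alpha>\<close> are read off from a single good fibre,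
    which exists because almost every fibre is good.\<close>
  obtain x where x: "exact_dimensional (m x) \<alpha>"
  proof -
    have "\<not> (AE x in \<U>. False)" by (simp add: U.AE_False)
    then have "\<exists>x. exact_dimensional (m x) \<alpha>" using fibre by (metis (mono_tags, lifting) eventually_mono)
    then show ?thesis using that by blast
  qed
  interpret m: prob_space "m x" by (rule prob_space_m)
  have "\<alpha> \<le> 1"
  proof (rule exact_dimensional_real_le_1[OF prob_space_m sets_m x])
    show "AE y in m x. \<bar>y\<bar> \<le> K / (1 - \<gamma>)"
      unfolding m_meas_def using S_bounded by (subst AE_distr_iff) auto
  qed
  moreover have "0 \<le> \<alpha>"
  proof -
    obtain y where y: "((\<lambda>r. ln (measure (m x) (ball y r)) / ln r) \<longlongrightarrow> \<alpha>) (at_right 0)"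
    proof -
      have "\<not> (AE y in m x. False)" by (simp add: m.AE_False)
      then have "\<exists>y. ((\<lambda>r. ln (measure (m x) (ball y r)) / ln r) \<longlongrightarrow> \<alpha>) (at_right 0)"
        using x unfolding exact_dimensional_def by (metis (mono_tags, lifting) eventually_mono)
      then show ?thesis using that by blast
    qed
    have "\<forall>\<^sub>F r in at_right (0::real). 0 \<le> ln (measure (m x) (ball y r)) / ln r"
      using eventually_at_right_real[of 0 1, OF zero_less_one]
    proof eventually_elim
      case (elim r)
      \<comment> \<open>At mass 0 the logarithm has the default value 0, so the sign is right there
        too.\<close>
      have "ln (measure (m x) (ball y r)) \<le> 0"
        by (cases "measure (m x) (ball y r) = 0") (auto simp: zero_less_measure_iff)
      then show ?case using elim by (intro divide_nonpos_nonpos) auto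
    qed
    then show ?thesis by (intro tendsto_lowerbound[OF y]) auto
  qed
  ultimately show ?thesis using 1 2 by (intro bexI[of _ \<alpha>]) (auto simp: omega_eq_W)
qed

end

theorem theorem3p1:
  fixes b :: nat and \<gamma> :: real and \<phi> :: "real \<Rightarrow> real"
  assumes "b \<ge> 2"
    and "0 < \<gamma>" and "\<gamma> < 1"
    and "\<And>x. \<phi> (x + 1) = \<phi> x"
    and "\<exists>C. C-lipschitz_on UNIV \<phi>"
  shows "(\<exists>\<beta>. exact_dimensional (omega_meas b \<gamma> \<phi>) \<beta>) \<and>
         (\<exists>\<alpha>\<in>{0..1}.
           (AE x in lborel. x \<in> {0..1} \<longrightarrow> exact_dimensional (m_meas b \<gamma> \<phi> x) \<alpha>)
         \<and> exact_dimensional (omega_meas b \<gamma> \<phi>) (1 + \<alpha>))"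
proof -
  from assms(5) obtain C where "C-lipschitz_on UNIV \<phi>" ..
  with assms(1-4) interpret skew_product b \<gamma> \<phi> C by unfold_locales
  show ?thesis using exact_dimensionality by blast
qed

end
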